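(* Consider the noiseless setting, and assume: (1) $\mathcal{H}_{-\infty}(\mathbf{X})<\infty$; (2) $\sum_{s=0}^{\infty} d(s;\mathbf{X})<\infty$; (3) $\mathcal{R}(\mathbf{X}):=\sup_{s\in\mathbb{N}_+}\mathbb{P}[X_1=X_{1+s}]<1$. Then there is a sequence $\epsilon_n\to 0$ (depending on $\beta$ and the law of $\mathbf X$) such that for all $n$ \[ P^*_{\mathrm{error}}\le 2(1+\epsilon_n)\left\{\beta\wedge \frac{1}{\mathcal{H}_1(\mathbf{X})}\right\}\frac{\log n}{n}, \] with the convention $1/0=\infty$.
   Context: Setting. Let $\mathcal X$ be a finite alphabet; logarithms are to base $|\mathcal X|$. Let $\mathbf X=\{X_i\}_{i\in\mathbb Z}$ be a stationary random process on $\mathcal X$. Fix $\beta>0$; for $n\in\mathbb N$ let $\ell=\ell(n)=\beta\log n$ (rounded to an integer) and $n_\ell:=n-(2\ell-1)$. Let $I(1)\sim\mathrm{Uniform}[n]$ and, conditionally on $I(1)$, let $I(2)$ be uniform on $I(1)+\{-\ell+1,\dots,n-\ell\}$ if $1\le I(1)\le \ell-1$, uniform on $[n]=\{1,\dots,n\}$ if $\ell\le I(1)\le n-\ell+1$, and uniform on $I(1)+\{\ell-n,\dots,\ell-1\}$ if $n-\ell+2\le I(1)\le n$; $(I(1),I(2))$ is independent of $\mathbf X$. The noiseless reads are $X_1^\ell(j):=X_{I(j)}^{I(j)+\ell-1}$, $j=1,2$. The signed overlap is $T:=\max\{0,\ell-(I(2)-I(1))\}$ if $I(2)\ge I(1)$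 and $T:=-\max\{0,\ell-(I(1)-I(2))\}$ if $I(2)<I(1)$; it takes values in $\mathcal T:=\{-(\ell-1),\dots,-1,0,1,\dots,\ell\}$ with $\mathbb P[T=0]=n_\ell/n$ and $\mathbb P[T=t]=1/n$ for $t\neq 0$. Given a finite alphabet $\mathcal Y$ and a Markov kernel $P_{Y_1^\ell\mid X_1^\ell}$ from $\mathcal X^\ell$ to $\mathcal Y^\ell$, the noisy reads $Y_1^\ell(j)$, $j=1,2$, are drawn from this kernel given $X_1^\ell(j)$, conditionally independently given the noiseless reads. A detector is any map $\hat T:\mathcal Y^\ell\times\mathcal Y^\ell\to\mathcal T$; $P_{\mathrm{error}}(\hat T):=\mathbb P[\hat T(Y_1^\ell(1),Y_1^\ell(2))\neq T]$ and $P^*_{\mathrm{error}}:=\min_{\hat T}P_{\mathrm{error}}(\hat T)$. Noiseless setting: $\mathbf X$ is stationary and ergodic and $Y_1^\ell=X_1^\ell$ with probability one. Rényi entropies: for a p.m.f. $P$, $H_\alpha(P)=\frac1{1-\alpha}\log\sum_x P^\alpha(x)$ for $\alpha\ne1$, $H_1(P)=-\sum_xP(x)\log P(x)$, and $H_{-\infty}(P)=-\log\min_{x\in\mathrm{supp}(P)}P(x)$. The order-$\alpha$ Rényi entropy rate is $\mathcal H_\alpha(\mathbf X):=\lim_{t\to\infty}\frac{1}{2t+1}H_\alpha(P_{X_{-t}^t})$; these limits are assumed to exist. Strong mixing coefficient: $d(s;\mathbf X):=\sup\{|\mathbb P[\mathcal F\mid\mathcal E]-\mathbb P[\mathcal F]|: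 i\in\mathbb Z,\ \mathcal E\in\sigma(X_{-\infty}^i),\ \mathcal F\in\sigma(X_{i+s}^\infty)\}$, taken w.l.o.g. to be non-increasing in $s$ (replace by $\sup_{s'\ge s}d(s')$). *)

theory Defs
  imports "HOL-Probability.Probability"
begin

text \<open>The process is represented by its law P on the path space int => 'a
  (coordinate process X_i(w) = w i).\<close>

definition path_space :: "(int \<Rightarrow> 'a) measure" where
  "path_space = PiM UNIV (\<lambda>_. count_space UNIV)"

definition shift :: "(int \<Rightarrow> 'a) \<Rightarrow> (int \<Rightarrow> 'a)" where
  "shift w = (\<lambda>i. w (i + 1))"

definition stationary_ergodic :: "(int \<Rightarrow> 'a) measure \<Rightarrow> bool" where
  "stationary_ergodic P \<longleftrightarrow>
     prob_space P \<and> sets P = sets path_space \<and>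
     shift \<in> measurable P P \<and> distr P P shift = P \<and>
     (\<forall>A\<in>sets P. shift -` A \<inter> space P = A \<longrightarrow> measure P A = 0 \<or> measure P A = 1)"

definition block_prob :: "(int \<Rightarrow> 'a) measure \<Rightarrow> nat \<Rightarrow> 'a list \<Rightarrow> real" where
  "block_prob P t w = measure P {x \<in> space P. \<forall>k < 2*t+1. x (int k - int t) = w ! k}"

definition blocks :: "nat \<Rightarrow> 'a list set" where
  "blocks m = {w. length w = m}"

definition renyi_entropy :: "real \<Rightarrow> real \<Rightarrow> 'b set \<Rightarrow> ('b \<Rightarrow> real) \<Rightarrow> real" where
  "renyi_entropy q \<alpha> S p =
     (if \<alpha> = 1 then - (\<Sum>x\<in>{x\<in>S. p x > 0}. p x * log q (p x))
      else (1 / (1 - \<alpha>)) * log q (\<Sum>x\<in>{x\<in>S. p x > 0}. p x powr \<alpha>))"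

definition renyi_entropy_minf :: "real \<Rightarrow> 'b set \<Rightarrow> ('b \<Rightarrow> real) \<Rightarrow> real" where
  "renyi_entropy_minf q S p = - log q (Min {p x | x. x \<in> S \<and> p x > 0})"

definition events_on :: "(int \<Rightarrow> 'a) measure \<Rightarrow> int set \<Rightarrow> (int \<Rightarrow> 'a) set set" where
  "events_on P J = sets (vimage_algebra (space P) (\<lambda>x. restrict x J) (PiM J (\<lambda>_. count_space UNIV)))"

definition mixing_coeff :: "(int \<Rightarrow> 'a) measure \<Rightarrow> nat \<Rightarrow> real" where
  "mixing_coeff P s =
     (SUP (i, E, F) \<in> {(i, E, F). E \<in> events_on P {..i} \<and> F \<in> events_on P {i + int s..}
                                \<and> measure P E > 0}.
        \<bar>measure P (F \<inter> E) / measure P E - measure P F\<bar>)"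

definition read_len :: "real \<Rightarrow> real \<Rightarrow> nat \<Rightarrow> nat" where
  "read_len q \<beta> n = nat (round (\<beta> * log q (real n)))"

definition second_set :: "nat \<Rightarrow> nat \<Rightarrow> int \<Rightarrow> int set" where
  "second_set n l i1 =
     (if 1 \<le> i1 \<and> i1 \<le> int l - 1 then {i1 - int l + 1 .. i1 + int n - int l}
      else if int l \<le> i1 \<and> i1 \<le> int n - int l + 1 then {1 .. int n}
      else {i1 + int l - int n .. i1 + int l - 1})"

definition index_pmf :: "nat \<Rightarrow> nat \<Rightarrow> (int \<times> int) pmf" where
  "index_pmf n l = bind_pmf (pmf_of_set {1 .. int n})
     (\<lambda>i1. bind_pmf (pmf_of_set (second_set n l i1)) (\<lambda>i2. return_pmf (i1, i2)))"

definition overlap :: "nat \<Rightarrow> int \<Rightarrow> int \<Rightarrow> int" where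
  "overlap l i1 i2 =
     (if i2 \<ge> i1 then max 0 (int l - (i2 - i1)) else - max 0 (int l - (i1 - i2)))"

definition overlap_range :: "nat \<Rightarrow> int set" where
  "overlap_range l = {- (int l - 1) .. int l} \<union> {0}"

definition read :: "nat \<Rightarrow> (int \<Rightarrow> 'a) \<Rightarrow> int \<Rightarrow> 'a list" where
  "read l x i = map (\<lambda>k. x (i + int k)) [0..<l]"

text \<open>Noiseless setting: Y = X. Error probability of a detector, with (I(1),I(2))
  independent of the process.\<close>
definition error_prob :: "(int \<Rightarrow> 'a) measure \<Rightarrow> nat \<Rightarrow> nat \<Rightarrow> ('a list \<Rightarrow> 'a list \<Rightarrow> int) \<Rightarrow> real" where
  "error_prob P n l Th =
     measure (measure_pmf (index_pmf n l) \<Otimes>\<^sub>M P)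
       {(ij, x). ij \<in> UNIV \<and> x \<in> space P \<and>
                 Th (read l x (fst ij)) (read l x (snd ij)) \<noteq> overlap l (fst ij) (snd ij)}"

definition opt_error :: "(int \<Rightarrow> 'a) measure \<Rightarrow> nat \<Rightarrow> nat \<Rightarrow> real" where
  "opt_error P n l = (INF Th \<in> {Th. \<forall>u v. Th u v \<in> overlap_range l}. error_prob P n l Th)"

end

theory Submission
  imports Defs "HOL-Real_Asymp.Real_Asymp"
begin

text \<open>Besides the constant detector \<open>0\<close>, consider the detector that reports an overlap \<open>t\<close> only if
  \<open>\<bar>t\<bar> \<ge> \<tau> = (1 + \<gamma>) log n / H\<close>, the reads match along \<open>t\<close>, and the matching word has probability at
  most \<open>\<theta> = n powr - (1 + \<gamma> / 2)\<close>. True overlaps shorter than \<open>\<tau>\<close> are missed, which costs about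
  \<open>2 \<tau> / n\<close>; everything else is of smaller order. A true long overlap has a word of probability
  above \<open>\<theta>\<close> with vanishing probability, by the lower half of the asymptotic equipartition property.
  A spurious match of two non-overlapping reads at distance \<open>s\<close> has probability at most
  \<open>\<theta> + d s\<close>, and \<open>d\<close> is summable. A spurious match of overlapping reads makes a long word agree with
  its own shift; these probabilities have a vanishing sum because word probabilities decay
  exponentially and \<open>P (X 1 = X (1 + s))\<close> is bounded away from \<open>1\<close>.

  The equipartition bound compares the law \<open>P\<close> of a long word with the product \<open>Q\<close> of its marginals on
  blocks of a large fixed length: \<open>- log Q\<close> is a sum of weakly correlated terms and obeys the weak law
  of large numbers, and \<open>log (P / Q)\<close> has small mean per symbol.\<close>

subsection \<open>Reads and stationarity\<close>

lemma length_read [simp]: "length (read l x i) = l"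
  by (simp add: read_def)

lemma nth_read [simp]: "k < l \<Longrightarrow> read l x i ! k = x (i + int k)"
  by (simp add: read_def)

lemma read_in_blocks [simp]: "read l x i \<in> blocks l"
  by (simp add: blocks_def)

lemma read_eq_iff: "read l x i = read l y j \<longleftrightarrow> (\<forall>k<l. x (i + int k) = y (j + int k))"
  by (auto simp: list_eq_iff_nth_eq)

lemma take_read: "m \<le> l \<Longrightarrow> take m (read l x i) = read m x i"
  by (auto simp: list_eq_iff_nth_eq)

lemma drop_read: "m \<le> l \<Longrightarrow> drop m (read l x i) = read (l - m) x (i + int m)"
  by (auto simp: list_eq_iff_nth_eq add.assoc)

lemma finite_blocks [simp]: "finite (blocks m :: 'a::finite list set)"
  unfolding blocks_def using finite_lists_length_eq[of "UNIV :: 'a set" m] by simp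

section \<open>Window sigma-algebras, shift invariance and the law of a word\<close>

locale stationary_process = prob_space P
  for P :: "(int \<Rightarrow> 'a::finite) measure" +
  assumes sets_P: "sets P = sets path_space"
    and shift_measurable: "shift \<in> measurable P P"
    and shift_invariant: "distr P P shift = P"
begin

lemma space_P [simp]: "space P = UNIV"
  using sets_eq_imp_space_eq[OF sets_P] by (simp add: path_space_def space_PiM)

text \<open>\<open>events_on\<close> is only a family of sets; a measure object on it makes
  \<open>measurable\<close> available for maps that depend on the coordinates in
  \<open>J\<close>.\<close>

definition sigma_on :: "int set \<Rightarrow> (int \<Rightarrow> 'a) measure" where
  "sigma_on J = vimage_algebra (space P) (\<lambda>x. restrict x J) (PiM J (\<lambda>_. count_space UNIV))"

lemma events_on_eq: "events_on P J = sets (sigma_on J)"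
  by (simp add: events_on_def sigma_on_def)

lemma space_sigma_on [simp]: "space (sigma_on J) = UNIV"
  by (simp add: sigma_on_def)

lemma coordinate_measurable_sigma_on:
  assumes "j \<in> J"
  shows "(\<lambda>x. x j) \<in> measurable (sigma_on J) (count_space UNIV)"
proof -
  have 1: "(\<lambda>x. restrict x J) \<in> measurable (sigma_on J) (PiM J (\<lambda>_. count_space UNIV))"
    unfolding sigma_on_def by (rule measurable_vimage_algebra1) (auto simp: space_PiM)
  have "(\<lambda>x. restrict x J j) \<in> measurable (sigma_on J) (count_space UNIV)"
    using measurable_compose[OF 1 measurable_component_singleton[OF assms]] .
  then show ?thesis using assms by simp
qed

lemma coordinate_event_sigma_on: "j \<in> J \<Longrightarrow> {x. x j = a} \<in> sets (sigma_on J)"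
  using measurable_sets[OF coordinate_measurable_sigma_on, of j J "{a}"]
  by (simp add: vimage_def)

text \<open>The alphabet is finite, so any predicate of a read, with no measurability condition on
  \<open>Q\<close>, is a finite union of cylinders.\<close>

lemma read_event_sigma_on:
  assumes "{i..<i + int m} \<subseteq> J"
  shows "{x. Q (read m x i)} \<in> sets (sigma_on J)"
proof -
  have word: "{x. read m x i = w} \<in> sets (sigma_on J)" if "length w = m" for w
  proof -
    have "{x. read m x i = w} = space (sigma_on J) \<inter> (\<Inter>k\<in>{..<m}. {x. x (i + int k) = w ! k})"
      using that by (auto simp: list_eq_iff_nth_eq)
    also have "\<dots> \<in> sets (sigma_on J)"
    proof (cases "m = 0")
      case False
      then show ?thesis
        using assms
        by (intro sets.Int sets.top sets.finite_INT) (auto intro!: coordinate_event_sigma_on)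
    qed (use sets.top[of "sigma_on J"] in simp)
    finally show ?thesis .
  qed
  have "{x. Q (read m x i)} = (\<Union>w\<in>{w\<in>blocks m. Q w}. {x. read m x i = w})"
    by auto
  also have "\<dots> \<in> sets (sigma_on J)"
    by (intro sets.finite_UN) (auto intro!: word simp: blocks_def finite_blocks[unfolded blocks_def])
  finally show ?thesis .
qed

lemma sigma_on_mono: "J \<subseteq> J' \<Longrightarrow> sets (sigma_on J) \<subseteq> sets (sigma_on J')"
proof -
  assume J: "J \<subseteq> J'"
  have "(\<lambda>x. restrict x J) \<in> measurable (sigma_on J') (PiM J (\<lambda>_. count_space UNIV))"
    by (rule measurable_restrict) (use J in \<open>auto intro: coordinate_measurable_sigma_on\<close>)
  from measurable_sets[OF this] show ?thesis
    unfolding sigma_on_def[of J] by (auto simp: sets_vimage_algebra2 space_PiM)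
qed

lemma sigma_on_subset_P: "sets (sigma_on J) \<subseteq> sets P"
proof -
  have "(\<lambda>x. restrict x J) \<in> measurable P (PiM J (\<lambda>_. count_space UNIV))"
  proof (rule measurable_restrict)
    fix j assume "j \<in> J"
    have "(\<lambda>x. x j) \<in> measurable path_space (count_space UNIV)"
      unfolding path_space_def by (rule measurable_component_singleton) simp
    then show "(\<lambda>x. x j) \<in> measurable P (count_space UNIV)"
      by (simp add: measurable_cong_sets[OF sets_P refl])
  qed
  from measurable_sets[OF this] show ?thesis
    unfolding sigma_on_def by (auto simp: sets_vimage_algebra2 space_PiM)
qed

lemma read_event [measurable]: "{x. Q (read m x i)} \<in> sets P"
  using read_event_sigma_on[of i m UNIV Q] sigma_on_subset_P by auto

lemma read_measurable [measurable]: "(\<lambda>x. read m x i) \<in> measurable P (count_space UNIV)"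
  by (rule measurableI) (auto simp: vimage_def intro: read_event)

text \<open>Invariance is given for one forward step and extended to all integers \<open>c\<close>
  by induction in both directions. Downwards only measurability has to be supplied, through the
  inverse shift; the equality of probabilities is the upward step read backwards.\<close>

lemma prob_shift:
  assumes "A \<in> sets P"
  shows "{x. (\<lambda>i. x (i + c)) \<in> A} \<in> sets P" "prob {x. (\<lambda>i. x (i + c)) \<in> A} = prob A"
proof -
  let ?B = "\<lambda>c. {x. (\<lambda>i. x (i + c)) \<in> A}"
  have step: "?B (c + 1) = shift -` ?B c \<inter> space P" for c
    by (auto simp: shift_def algebra_simps)
  have inv: "prob (shift -` B \<inter> space P) = prob B" if "B \<in> sets P" for B
    using measure_distr[OF shift_measurable that] shift_invariant by simp
  have up: "?B c \<in> sets P \<Longrightarrow> ?B (c + 1) \<in> sets P \<and> prob (?B (c + 1)) = prob (?B c)" for c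
    unfolding step using inv measurable_sets[OF shift_measurable] by blast
  have unshift: "(\<lambda>x. (\<lambda>i. x (i - 1))) \<in> measurable P P"
  proof -
    have "(\<lambda>x. (\<lambda>i. x (i - 1))) \<in> measurable path_space path_space"
      unfolding path_space_def
      by (rule measurable_PiM_single') (auto simp: space_PiM intro: measurable_component_singleton)
    then show ?thesis
      by (simp add: measurable_cong_sets[OF sets_P sets_P])
  qed
  have down: "?B (c - 1) \<in> sets P" if "?B c \<in> sets P" for c
  proof -
    have "?B (c - 1) = (\<lambda>x. (\<lambda>i. x (i - 1))) -` ?B c \<inter> space P"
      by (auto simp: algebra_simps)
    then show ?thesis using measurable_sets[OF unshift that] by simp
  qed
  have "?B c \<in> sets P \<and> prob (?B c) = prob A"
  proof (induction c rule: int_induct[where k = 0])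
    case (step2 i)
    then show ?case using down[of i] up[of "i - 1"] by simp
  qed (use assms up in auto)
  then show "?B c \<in> sets P" "prob (?B c) = prob A" by auto
qed

lemma read2_event: "{x. Q (read m x i) (read k x j)} \<in> sets P"
proof -
  have "{x. Q (read m x i) (read k x j)}
      = (\<Union>w\<in>blocks m. {x. read m x i = w} \<inter> {x. Q w (read k x j)})"
    by auto
  also have "\<dots> \<in> sets P"
    by (intro sets.finite_UN sets.Int read_event) auto
  finally show ?thesis .
qed

lemma prob_read_shift: "prob {x. Q (read m x (i + c)) (read k x (j + c))} = prob {x. Q (read m x i) (read k x j)}"
proof -
  from prob_shift(2)[OF read2_event[of Q m i k j], of c] show ?thesis
    by (simp add: read_def algebra_simps)
qed

text \<open>Stationarity makes the position \<open>0\<close> immaterial. Taking the length from the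
  word itself gives one function for all lengths, so that a word and its prefixes can be
  compared.\<close>

definition word_prob :: "'a list \<Rightarrow> real" where
  "word_prob w = prob {x. read (length w) x 0 = w}"

lemma prob_read_eq: "w \<in> blocks m \<Longrightarrow> prob {x. read m x i = w} = word_prob w"
  using prob_read_shift[of "\<lambda>u v. u = w" m 0 i 0 0] by (simp add: word_prob_def blocks_def)

lemma word_prob_nonneg [simp]: "0 \<le> word_prob w"
  by (simp add: word_prob_def)

lemma word_prob_le_1 [simp]: "word_prob w \<le> 1"
  by (simp add: word_prob_def)

lemma word_prob_take_le: "word_prob w \<le> word_prob (take k w)"
proof -
  have "{x. read (length w) x 0 = w} \<subseteq> {x. read (length (take k w)) x 0 = take k w}"
    by (auto simp: list_eq_iff_nth_eq)
  then show ?thesis unfolding word_prob_def by (rule finite_measure_mono) (rule read_event)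
qed

lemma prob_read_sum:
  assumes "E \<in> sets P"
  shows "prob E = (\<Sum>w\<in>blocks m. prob (E \<inter> {x. read m x i = w}))"
proof -
  have "prob E = prob (\<Union>w\<in>blocks m. E \<inter> {x. read m x i = w})"
    by (rule arg_cong[where f = prob]) auto
  also have "\<dots> = (\<Sum>w\<in>blocks m. prob (E \<inter> {x. read m x i = w}))"
    by (rule finite_measure_finite_Union)
      (use assms in \<open>auto simp: disjoint_family_on_def intro!: sets.Int read_event\<close>)
  finally show ?thesis .
qed

lemma sum_word_prob [simp]: "(\<Sum>w\<in>blocks m. word_prob w) = 1"
  using prob_read_sum[of UNIV m 0] prob_space prob_read_eq[of _ m 0] sets.top[of P] by simp

lemma integrable_read: "integrable P (\<lambda>x. f (read m x i) :: real)"
proof (rule integrable_const_bound[where B = "Max ((\<lambda>w. \<bar>f w\<bar>) ` blocks m)"])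
  show "(\<lambda>x. f (read m x i)) \<in> borel_measurable P" by measurable
qed (auto intro!: Max_ge)

lemma sum_read_indicator:
  fixes x :: "int \<Rightarrow> 'a"
  shows "(\<Sum>w\<in>blocks m. f w * indicator {x. read m x i = w} x) = (f (read m x i) :: real)"
proof -
  have "(\<Sum>w\<in>blocks m. f w * indicator {x. read m x i = w} x)
      = (\<Sum>w\<in>blocks m. if w = read m x i then f w else 0)"
    by (rule sum.cong) auto
  then show ?thesis by simp
qed

lemma expectation_read: "expectation (\<lambda>x. f (read m x i)) = (\<Sum>w\<in>blocks m. word_prob w * f w)"
proof -
  have "expectation (\<lambda>x. f (read m x i))
      = expectation (\<lambda>x. \<Sum>w\<in>blocks m. f w * indicator {x. read m x i = w} x)"
    by (simp only: sum_read_indicator)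
  also have "\<dots> = (\<Sum>w\<in>blocks m. f w * prob {x. read m x i = w})"
    by (subst Bochner_Integration.integral_sum)
       (auto intro!: integrable_mult_right integrable_real_indicator simp: emeasure_eq_measure)
  also have "\<dots> = (\<Sum>w\<in>blocks m. word_prob w * f w)"
    by (rule sum.cong) (auto simp: prob_read_eq)
  finally show ?thesis .
qed

end

subsection \<open>Mixing and repeated words\<close>

context stationary_process
begin

abbreviation mix :: "nat \<Rightarrow> real" where
  "mix \<equiv> mixing_coeff P"

text \<open>A supremum of reals dominates its members only if they are bounded above; this supplies
  the bound for \<open>mixing_coeff\<close>.\<close>

lemma conditional_deviation_le_1: "E \<in> sets P \<Longrightarrow> 0 < prob E \<Longrightarrow> \<bar>prob (F \<inter> E) / prob E - prob F\<bar> \<le> 1"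
proof -
  assume E: "E \<in> sets P" "0 < prob E"
  have "prob (F \<inter> E) \<le> prob E" using E by (intro finite_measure_mono) auto
  then have "0 \<le> prob (F \<inter> E) / prob E" "prob (F \<inter> E) / prob E \<le> 1" using E by auto
  moreover have "0 \<le> prob F" "prob F \<le> 1" by auto
  ultimately show ?thesis by linarith
qed

lemma mix_upper:
  assumes E: "E \<in> sets (sigma_on {..i})" and F: "F \<in> sets (sigma_on {i + int s..})" and "0 < prob E"
  shows "\<bar>prob (F \<inter> E) / prob E - prob F\<bar> \<le> mix s"
proof -
  let ?f = "\<lambda>(i :: int, E, F). \<bar>prob (F \<inter> E) / prob E - prob F\<bar>"
  let ?S = "{(i, E, F). E \<in> events_on P {..i} \<and> F \<in> events_on P {i + int s..} \<and> prob E > 0}"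
  have "bdd_above (?f ` ?S)"
    by (rule bdd_aboveI[where M = 1])
      (use sigma_on_subset_P in \<open>auto simp: events_on_eq intro!: conditional_deviation_le_1\<close>)
  then have "?f (i, E, F) \<le> (SUP z\<in>?S. ?f z)"
    by (rule cSUP_upper[rotated]) (use assms in \<open>auto simp: events_on_eq\<close>)
  then show ?thesis unfolding mixing_coeff_def by simp
qed

lemma mix_nonneg: "0 \<le> mix s"
  using mix_upper[of UNIV 0 UNIV s] sets.top[of "sigma_on {..0}"] sets.top[of "sigma_on {0 + int s..}"]
    prob_space
  by simp

text \<open>Multiplying by \<open>prob E\<close> disposes of the condition
  \<open>0 < prob E\<close>, because both sides vanish for a null event. The factor
  \<open>prob E\<close> on the right lets the errors be summed over a partition.\<close>

lemma prob_inter_mix: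
  assumes E: "E \<in> sets (sigma_on J)" and F: "F \<in> sets (sigma_on J')"
    and J: "J \<subseteq> {..i}" and J': "J' \<subseteq> {i + int s..}"
  shows "\<bar>prob (E \<inter> F) - prob E * prob F\<bar> \<le> prob E * mix s"
proof (cases "prob E = 0")
  case True
  have "prob (E \<inter> F) \<le> prob E" using E sigma_on_subset_P by (intro finite_measure_mono) auto
  with True show ?thesis by simp
next
  case False
  then have pos: "0 < prob E" by (simp add: zero_less_measure_iff)
  have "\<bar>prob (F \<inter> E) / prob E - prob F\<bar> \<le> mix s"
    using mix_upper[OF _ _ pos] E F sigma_on_mono[OF J] sigma_on_mono[OF J'] by blast
  then have "prob E * \<bar>prob (F \<inter> E) / prob E - prob F\<bar> \<le> prob E * mix s"
    using pos by (intro mult_left_mono) auto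
  moreover have "prob E * \<bar>prob (F \<inter> E) / prob E - prob F\<bar> = \<bar>prob E * (prob (F \<inter> E) / prob E - prob F)\<bar>"
    using pos by (simp add: abs_mult)
  moreover have "prob E * (prob (F \<inter> E) / prob E - prob F) = prob (E \<inter> F) - prob E * prob F"
    using pos by (simp add: right_diff_distrib Int_commute)
  ultimately show ?thesis by simp
qed

lemma prob_inter_mix_le:
  assumes "E \<in> sets (sigma_on J)" "F \<in> sets (sigma_on J')" "J \<subseteq> {..i}" "J' \<subseteq> {i + int s..}"
  shows "prob (E \<inter> F) \<le> prob E * (prob F + mix s)"
  using prob_inter_mix[OF assms] by (simp add: algebra_simps abs_le_iff)

text \<open>Windows of \<open>w + 1\<close> coordinates start every \<open>M\<close> positions. The
  last window is at distance \<open>M - w\<close> from the earlier ones, so splitting it off costs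
  one factor \<open>\<rho> + mix (M - w)\<close>.\<close>

lemma prob_spaced_events_le:
  assumes F: "\<And>k. k < K \<Longrightarrow> F k \<in> sets (sigma_on {int (k * M)..int (k * M + w)})"
    and \<rho>: "\<And>k. k < K \<Longrightarrow> prob (F k) \<le> \<rho>" and M: "w < M"
  shows "prob (\<Inter>k<K. F k) \<le> (\<rho> + mix (M - w)) ^ K"
  using F \<rho>
proof (induction K)
  case 0
  then show ?case by simp
next
  case (Suc K)
  \<comment> \<open>The last of the first \<open>K\<close> windows ends at
    \<open>(K - 1) * M + w\<close>, which is \<open>K * M - (M - w)\<close>.\<close>
  have "(\<Inter>k<K. F k) \<in> sets (sigma_on {..int (K * M) - int (M - w)})"
  proof (cases "K = 0")
    case True
    then show ?thesis using sets.top[of "sigma_on {..int (K * M) - int (M - w)}"] by simp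
  next
    case False
    have "F k \<in> sets (sigma_on {..int (K * M) - int (M - w)})" if "k < K" for k
    proof -
      have "Suc k * M \<le> K * M" using that by (intro mult_right_mono) auto
      then have "int (k * M) + int M \<le> int (K * M)" unfolding of_nat_add[symmetric] of_nat_le_iff by simp
      then have "{int (k * M)..int (k * M + w)} \<subseteq> {..int (K * M) - int (M - w)}"
        using M by (auto simp del: of_nat_mult)
      then show ?thesis
        using sigma_on_mono Suc.prems(1)[of k] that by (meson less_SucI subsetD)
    qed
    then show ?thesis using False by (intro sets.finite_INT) auto
  qed
  then have "prob ((\<Inter>k<K. F k) \<inter> F K) \<le> prob (\<Inter>k<K. F k) * (prob (F K) + mix (M - w))"
    using Suc.prems(1)[of K] by (rule prob_inter_mix_le) auto
  also have "\<dots> \<le> (\<rho> + mix (M - w)) ^ K * (\<rho> + mix (M - w))"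
    using Suc.IH Suc.prems mix_nonneg[of "M - w"]
    by (intro mult_mono) (auto intro!: add_nonneg_nonneg zero_le_power intro: order_trans[OF measure_nonneg[of P "F K"]])
  finally show ?case by (simp add: lessThan_Suc Int_commute mult.commute)
qed

text \<open>Condition on the first occurrence being \<open>w\<close>: the second must then equal
  this fixed word, which has probability at most \<open>\<theta>\<close> up to the mixing error. The
  weights \<open>word_prob w\<close> sum to 1, so only the largest accepted word probability
  enters.\<close>

lemma prob_repeat_le:
  assumes W: "\<And>w. w \<in> blocks t \<Longrightarrow> Q w \<Longrightarrow> word_prob w \<le> \<theta>" and "0 \<le> \<theta>"
    and gap: "u + int t + int s \<le> v"
  shows "prob {x. read t x u = read t x v \<and> Q (read t x u)} \<le> \<theta> + mix s"
proof -
  let ?M = "{x. read t x u = read t x v \<and> Q (read t x u)}"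
  have le: "prob (?M \<inter> {x. read t x u = w}) \<le> word_prob w * (\<theta> + mix s)" if w: "w \<in> blocks t" for w
  proof (cases "Q w")
    case True
    have "prob (?M \<inter> {x. read t x u = w}) = prob ({x. read t x u = w} \<inter> {x. read t x v = w})"
      using True by (intro arg_cong[where f = prob]) auto
    also have "\<dots> \<le> prob {x. read t x u = w} * (prob {x. read t x v = w} + mix s)"
      by (rule prob_inter_mix_le[where i = "u + int t" and J = "{u..<u + int t}" and J' = "{v..<v + int t}"])
        (use gap in \<open>auto intro!: read_event_sigma_on\<close>)
    also have "\<dots> \<le> word_prob w * (\<theta> + mix s)"
      using W[OF w True] w by (auto simp: prob_read_eq intro!: mult_left_mono)
    finally show ?thesis .
  next
    case False
    then have "?M \<inter> {x. read t x u = w} = {}" by auto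
    then show ?thesis using mix_nonneg[of s] \<open>0 \<le> \<theta>\<close> by simp
  qed
  have "prob ?M = (\<Sum>w\<in>blocks t. prob (?M \<inter> {x. read t x u = w}))"
    by (rule prob_read_sum) (rule read2_event)
  also have "\<dots> \<le> (\<Sum>w\<in>blocks t. word_prob w * (\<theta> + mix s))"
    by (rule sum_mono) (rule le)
  also have "\<dots> = \<theta> + mix s"
    by (simp flip: sum_distrib_right)
  finally show ?thesis .
qed

text \<open>For \<open>r < t\<close> the two windows overlap, and the event says that a stretch of
  \<open>t + r\<close> letters has period \<open>r\<close>.\<close>

definition repeat_prob :: "nat \<Rightarrow> nat \<Rightarrow> real" where
  "repeat_prob r t = prob {x. read t x 0 = read t x (int r)}"

lemma repeat_prob_nonneg [simp]: "0 \<le> repeat_prob r t"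
  by (simp add: repeat_prob_def)

lemma repeat_prob_mono: "k \<le> t \<Longrightarrow> repeat_prob r t \<le> repeat_prob r k"
  unfolding repeat_prob_def
  by (rule finite_measure_mono[OF _ read2_event]) (auto simp: read_eq_iff)

lemma prob_match_eq: "prob {x. read t x u = read t x v} = repeat_prob (nat \<bar>v - u\<bar>) t"
proof -
  have *: "prob {x. read t x u = read t x v} = repeat_prob (nat (v - u)) t" if "u \<le> v" for u v
    using prob_read_shift[of "\<lambda>a b. a = b" t 0 u t "v - u"] that by (simp add: repeat_prob_def)
  show ?thesis
  proof (cases "u \<le> v")
    case True
    then show ?thesis using * by simp
  next
    case False
    have "prob {x. read t x u = read t x v} = prob {x. read t x v = read t x u}"
      by (simp add: eq_commute)
    then show ?thesis using *[of v u] False by simp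
  qed
qed

end

section \<open>Exponential decay of word probabilities and vanishing sums of repeat
  probabilities\<close>

locale mixing_process = stationary_process P for P :: "(int \<Rightarrow> 'a::finite) measure" +
  assumes mix_summable: "summable (mixing_coeff P)"
    and agreement_SUP: "(SUP s \<in> {1::nat..}. measure P {x \<in> space P. x 1 = x (1 + int s)}) < 1"
begin

definition agreement :: real where
  "agreement = (SUP s \<in> {1::nat..}. measure P {x \<in> space P. x 1 = x (1 + int s)})"

lemma agreement_less_1: "agreement < 1"
  using agreement_SUP by (simp add: agreement_def)

lemma prob_agree_le:
  assumes "1 \<le> r"
  shows "prob {x. x i = x (i + int r)} \<le> agreement"
proof -
  have "prob {x. x i = x (i + int r)} = prob {x. read 1 x i = read 1 x (i + int r)}"
    by (simp add: read_eq_iff)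
  also have "\<dots> = prob {x. read 1 x 1 = read 1 x (1 + int r)}"
    by (simp only: prob_match_eq) simp
  also have "\<dots> = prob {x \<in> space P. x 1 = x (1 + int r)}"
    by (simp add: read_eq_iff)
  also have "\<dots> \<le> agreement"
    unfolding agreement_def
    by (rule cSUP_upper) (use assms in \<open>auto intro!: bdd_aboveI[where M = 1]\<close>)
  finally show ?thesis .
qed

lemma mix_tendsto_0: "mix \<longlonglongrightarrow> 0"
  using mix_summable by (rule summable_LIMSEQ_zero)

text \<open>If a letter has probability \<open>p\<close>, two neighbouring coordinates both equal it
  with probability at least \<open>2 * p - 1\<close>, and they agree in that case.\<close>

lemma coordinate_prob_le: "prob {x. x i = a} \<le> (1 + agreement) / 2"
proof -
  have ev: "{x. x j = a} \<in> sets P" for j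
    using coordinate_event_sigma_on[of j UNIV a] sigma_on_subset_P by auto
  have pr: "prob {x. x j = a} = word_prob [a]" for j
    using prob_read_eq[of "[a]" 1 j] by (simp add: blocks_def read_def)
  have agr: "{x. x i = x (i + int 1)} \<in> sets P"
    using read2_event[of "\<lambda>u v. u = v" 1 i 1 "i + 1"] by (simp add: read_eq_iff)
  have "prob ({x. x i = a} \<union> {x. x (i + 1) = a})
      = prob {x. x i = a} + prob {x. x (i + 1) = a} - prob ({x. x i = a} \<inter> {x. x (i + 1) = a})"
    by (rule measure_Un3) (auto simp: fmeasurable_eq_sets ev)
  moreover have "prob ({x. x i = a} \<union> {x. x (i + 1) = a}) \<le> 1" by simp
  moreover have "prob ({x. x i = a} \<inter> {x. x (i + 1) = a}) \<le> prob {x. x i = x (i + int 1)}"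
    by (rule finite_measure_mono) (use agr in auto)
  moreover have "prob {x. x i = x (i + int 1)} \<le> agreement"
    by (rule prob_agree_le) simp
  ultimately show ?thesis using pr by simp
qed

lemma mix_gap_exists:
  assumes "\<rho> < (1::real)"
  obtains s where "0 < s" "\<rho> + mix s < 1"
proof -
  have "eventually (\<lambda>s. mix s < 1 - \<rho>) sequentially"
    using order_tendstoD(2)[OF mix_tendsto_0] assms by simp
  then obtain N where "\<And>s. s \<ge> N \<Longrightarrow> mix s < 1 - \<rho>"
    by (auto simp: eventually_sequentially)
  from this[of "Suc N"] show ?thesis by (intro that[of "Suc N"]) auto
qed

text \<open>Sample the word at every \<open>M\<close>-th letter. Each sampled letter has probability
  at most \<open>(1 + agreement) / 2 < 1\<close>, and for a suitable \<open>M\<close> the mixing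
  error keeps the factor per sample below 1; \<open>\<rho>\<close> is its \<open>M\<close>-th
  root.\<close>

lemma word_prob_exponential:
  obtains c \<rho> where "0 < c" "0 < \<rho>" "\<rho> < 1" "\<And>w. word_prob w \<le> c * \<rho> ^ length w"
proof -
  let ?\<sigma>0 = "(1 + agreement) / 2"
  obtain M where M: "0 < M" "?\<sigma>0 + mix M < 1"
    using mix_gap_exists[of ?\<sigma>0] agreement_less_1 by auto
  define \<sigma> where "\<sigma> = ?\<sigma>0 + mix M"
  have \<sigma>_pos: "0 < \<sigma>"
  proof -
    have "0 \<le> agreement" using prob_agree_le[of 1 0] measure_nonneg by (metis order_trans order_refl)
    then have "0 < ?\<sigma>0" by simp
    then show ?thesis unfolding \<sigma>_def using mix_nonneg[of M] by (rule add_pos_nonneg)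
  qed
  define \<rho> where "\<rho> = root M \<sigma>"
  have \<rho>: "0 < \<rho>" "\<rho> < 1" "\<rho> ^ M = \<sigma>"
    using M \<sigma>_pos by (auto simp: \<rho>_def \<sigma>_def real_root_lt_1_iff)
  have "word_prob w \<le> 1 / \<sigma> * \<rho> ^ length w" for w
  proof -
    let ?n = "length w" and ?K = "length w div M"
    let ?F = "\<lambda>k. {x. x (int (k * M)) = w ! (k * M)}"
    have idx: "k * M < ?n" if "k < ?K" for k
    proof -
      have "Suc k * M \<le> ?K * M" using that by (intro mult_right_mono) auto
      also have "\<dots> \<le> ?n" by simp
      finally show ?thesis using M by simp
    qed
    have "word_prob w \<le> prob (\<Inter>k<?K. ?F k)"
      unfolding word_prob_def
    proof (rule finite_measure_mono)
      show "(\<Inter>k<?K. ?F k) \<in> sets P"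
      proof (cases "?K = 0")
        case False
        then show ?thesis
          using coordinate_event_sigma_on[of _ UNIV] sigma_on_subset_P
          by (intro sets.finite_INT) auto
      qed (use sets.top[of P] in simp)
      show "{x. read ?n x 0 = w} \<subseteq> (\<Inter>k<?K. ?F k)"
        using idx by (auto simp: list_eq_iff_nth_eq simp del: of_nat_mult)
    qed
    also have "\<dots> \<le> (?\<sigma>0 + mix (M - 0)) ^ ?K"
      by (rule prob_spaced_events_le)
        (use M in \<open>auto intro!: coordinate_event_sigma_on coordinate_prob_le[simplified]\<close>)
    also have "\<dots> = \<rho> ^ (M * ?K)"
      by (simp add: power_mult \<rho> \<sigma>_def)
    \<comment> \<open>The remainder \<open>?n mod M\<close> is less than \<open>M\<close>, so
      \<open>\<sigma> = \<rho> ^ M\<close> is at most \<open>\<rho> ^ (?n mod M)\<close>. This is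
      the origin of the constant \<open>1 / \<sigma>\<close>.\<close>
    also have "\<dots> * \<sigma> \<le> \<rho> ^ (M * ?K) * \<rho> ^ (?n mod M)"
      unfolding \<rho>(3)[symmetric] using \<rho> M by (intro mult_left_mono power_decreasing) auto
    then have "\<rho> ^ (M * ?K) \<le> 1 / \<sigma> * \<rho> ^ ?n"
      using \<sigma>_pos by (simp add: field_simps flip: power_add)
    finally show ?thesis .
  qed
  then show ?thesis using that[of "1 / \<sigma>" \<rho>] \<rho> \<sigma>_pos by auto
qed

text \<open>A repeat forces the letters at distance \<open>r\<close> to agree at every
  \<open>(r + s)\<close>-th position. Such a pair spans \<open>r + 1\<close> coordinates, leaving a
  gap \<open>s\<close> to the next pair, so each pair contributes a factor below 1. The rate depends
  on \<open>r\<close>, so this serves only finitely many shifts.\<close>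

lemma repeat_prob_tendsto_0:
  assumes "1 \<le> r"
  shows "(\<lambda>t. repeat_prob r t) \<longlonglongrightarrow> 0"
proof -
  obtain s where s: "0 < s" "agreement + mix s < 1"
    using mix_gap_exists[OF agreement_less_1] by auto
  let ?M = "r + s" and ?\<sigma> = "agreement + mix s"
  have "0 \<le> agreement" using prob_agree_le[of 1 0] measure_nonneg by (metis order_trans order_refl)
  then have \<sigma>: "0 \<le> ?\<sigma>" using mix_nonneg[of s] by simp
  have le: "repeat_prob r t \<le> ?\<sigma> ^ (t div ?M)" for t
  proof -
    let ?F = "\<lambda>k. {x. x (int (k * ?M)) = x (int (k * ?M) + int r)}"
    have F: "?F k \<in> sets (sigma_on {int (k * ?M)..int (k * ?M + r)})" for k
    proof -
      have "?F k = {x. (\<lambda>w. w ! 0 = w ! r) (read (Suc r) x (int (k * ?M)))}"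
        by (simp del: of_nat_mult)
      also have "\<dots> \<in> sets (sigma_on {int (k * ?M)..int (k * ?M + r)})"
        by (rule read_event_sigma_on) auto
      finally show ?thesis .
    qed
    have idx: "k * ?M < t" if "k < t div ?M" for k
    proof -
      have "Suc k * ?M \<le> t div ?M * ?M" using that by (intro mult_right_mono) auto
      also have "\<dots> \<le> t" by simp
      finally show ?thesis using s by simp
    qed
    have "repeat_prob r t \<le> prob (\<Inter>k<t div ?M. ?F k)"
      unfolding repeat_prob_def
    proof (rule finite_measure_mono)
      show "(\<Inter>k<t div ?M. ?F k) \<in> sets P"
      proof (cases "t div ?M = 0")
        case False
        then show ?thesis
          using F sigma_on_subset_P by (intro sets.finite_INT) blast+
      qed (use sets.top[of P] in simp)
      show "{x. read t x 0 = read t x (int r)} \<subseteq> (\<Inter>k<t div ?M. ?F k)"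
        using idx by (auto simp: read_eq_iff add.commute simp del: of_nat_mult of_nat_add)
    qed
    also have "\<dots> \<le> (agreement + mix (?M - r)) ^ (t div ?M)"
      by (rule prob_spaced_events_le[OF F prob_agree_le[OF assms]]) (use s in simp)
    finally show ?thesis by simp
  qed
  have "(\<lambda>K. ?\<sigma> ^ K) \<longlonglongrightarrow> 0"
    using s \<sigma> by (intro LIMSEQ_power_zero) simp
  moreover have "filterlim (\<lambda>t. t div ?M) at_top sequentially"
    using s by (intro filterlim_at_top_div_const_nat) simp
  ultimately have "(\<lambda>t. ?\<sigma> ^ (t div ?M)) \<longlonglongrightarrow> 0"
    by (rule filterlim_compose)
  then show ?thesis
    by (rule Lim_null_comparison[rotated]) (use le in auto)
qed

text \<open>For a large shift the two occurrences of the first \<open>r div 2\<close> letters are separated by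
  at least \<open>r div 2\<close>, so that mixing applies although the full blocks may overlap.\<close>

lemma repeat_prob_le:
  assumes c: "\<And>w. word_prob w \<le> c * \<rho> ^ length w" and \<rho>: "0 < \<rho>" "\<rho> < 1" and "0 < c"
  shows "repeat_prob r t \<le> c * \<rho> ^ t + c * \<rho> ^ (r div 2) + mix (r div 2)"
proof -
  let ?k = "min t (r div 2)"
  have "repeat_prob r t \<le> repeat_prob r ?k"
    by (rule repeat_prob_mono) simp
  also have "\<dots> = prob {x. read ?k x 0 = read ?k x (int r) \<and> True}"
    by (simp add: repeat_prob_def)
  \<comment> \<open>As \<open>?k\<close> is at most \<open>r div 2\<close>, the windows leave a gap
    of at least \<open>r div 2\<close>.\<close>
  also have "\<dots> \<le> c * \<rho> ^ ?k + mix (r div 2)"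
  proof (rule prob_repeat_le)
    fix w :: "'a list" assume "w \<in> blocks ?k"
    then have "length w = ?k" by (simp add: blocks_def)
    with c[of w] show "word_prob w \<le> c * \<rho> ^ ?k" by metis
  qed (use \<rho> \<open>0 < c\<close> in auto)
  also have "c * \<rho> ^ ?k \<le> c * \<rho> ^ t + c * \<rho> ^ (r div 2)"
    using \<rho> \<open>0 < c\<close> by (cases "t \<le> r div 2") (auto simp: min_def)
  finally show ?thesis by simp
qed

lemma summable_div2:
  fixes f :: "nat \<Rightarrow> real"
  assumes f: "summable f" and nonneg: "\<And>n. 0 \<le> f n"
  shows "summable (\<lambda>n. f (n div 2))"
proof (rule summableI_nonneg_bounded)
  fix n
  have "(\<Sum>i<n. f (i div 2)) \<le> (\<Sum>i<2 * n. f (i div 2))"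
    by (rule sum_mono2) (auto simp: nonneg)
  \<comment> \<open>Each \<open>f i\<close> occurs exactly twice, at the indices
    \<open>2 * i\<close> and \<open>2 * i + 1\<close>.\<close>
  also have "\<dots> = 2 * (\<Sum>i<n. f i)"
    by (induction n) auto
  also have "\<dots> \<le> 2 * suminf f"
    using sum_le_suminf[OF f, of "{..<n}"] nonneg by simp
  finally show "(\<Sum>i<n. f (i div 2)) \<le> 2 * suminf f" .
qed (rule nonneg)

text \<open>Split the shifts at \<open>r0\<close>. The finitely many small ones vanish individually
  as \<open>t\<close> grows. For the others \<open>repeat_prob_le\<close> gives the tail of a
  summable series plus at most \<open>N * c * \<rho> ^ t\<close>, which tends to 0 because
  \<open>N\<close> grows at most linearly in \<open>t\<close>.\<close>

lemma sum_repeat_prob_small: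
  assumes "0 < \<epsilon>" "0 \<le> C"
  obtains t0 where "\<And>t N. t0 \<le> t \<Longrightarrow> real N \<le> C * real t \<Longrightarrow> (\<Sum>r=1..N. repeat_prob r t) \<le> \<epsilon>"
proof -
  obtain c \<rho> where c: "0 < c" and \<rho>: "0 < \<rho>" "\<rho> < 1" and wp: "\<And>w. word_prob w \<le> c * \<rho> ^ length w"
    using word_prob_exponential by blast
  define f where "f n = c * \<rho> ^ n + mix n" for n
  have f_nonneg: "0 \<le> f n" for n using c \<rho> mix_nonneg by (simp add: f_def)
  have "summable f" unfolding f_def
    using \<rho> by (intro summable_add summable_mult summable_geometric mix_summable) simp
  then have sf: "summable (\<lambda>n. f (n div 2))" using f_nonneg by (rule summable_div2)
  obtain r0 where r0: "\<And>n. n \<ge> r0 \<Longrightarrow> norm (\<Sum>i. f ((i + n) div 2)) < \<epsilon> / 3"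
    using suminf_exist_split[OF _ sf, of "\<epsilon> / 3"] assms by auto
  have "(\<lambda>t. \<Sum>r\<in>{1..<Suc r0}. repeat_prob r t) \<longlonglongrightarrow> (\<Sum>r\<in>{1..<Suc r0}. 0)"
    by (rule tendsto_sum) (use repeat_prob_tendsto_0 in auto)
  then have "eventually (\<lambda>t. (\<Sum>r\<in>{1..<Suc r0}. repeat_prob r t) < \<epsilon> / 3) sequentially"
    using assms by (intro order_tendstoD(2)) auto
  moreover have "(\<lambda>t. C * c * (real t * \<rho> ^ t)) \<longlonglongrightarrow> C * c * 0"
    by (intro tendsto_intros powser_times_n_limit_0) (use \<rho> in auto)
  then have "eventually (\<lambda>t. C * c * (real t * \<rho> ^ t) < \<epsilon> / 3) sequentially"
    using assms by (intro order_tendstoD(2)) auto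
  ultimately have "eventually (\<lambda>t. (\<Sum>r\<in>{1..<Suc r0}. repeat_prob r t) < \<epsilon> / 3 \<and>
      C * c * (real t * \<rho> ^ t) < \<epsilon> / 3) sequentially"
    by eventually_elim auto
  then obtain t0 where t0: "\<And>t. t \<ge> t0 \<Longrightarrow> (\<Sum>r\<in>{1..<Suc r0}. repeat_prob r t) < \<epsilon> / 3 \<and>
      C * c * (real t * \<rho> ^ t) < \<epsilon> / 3"
    by (auto simp: eventually_sequentially)
  show ?thesis
  proof (rule that)
    fix t N assume t: "t0 \<le> t" and N: "real N \<le> C * real t"
    have "(\<Sum>r=1..N. repeat_prob r t) \<le> (\<Sum>r\<in>{1..<Suc r0} \<union> {Suc r0..N}. repeat_prob r t)"
      by (rule sum_mono2) auto
    also have "\<dots> = (\<Sum>r\<in>{1..<Suc r0}. repeat_prob r t) + (\<Sum>r\<in>{Suc r0..N}. repeat_prob r t)"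
      by (rule sum.union_disjoint) auto
    also have "(\<Sum>r\<in>{Suc r0..N}. repeat_prob r t) \<le> (\<Sum>r\<in>{Suc r0..N}. c * \<rho> ^ t + f (r div 2))"
      by (rule sum_mono) (use repeat_prob_le[OF wp \<rho> c] in \<open>simp add: f_def add.assoc\<close>)
    also have "\<dots> = real (card {Suc r0..N}) * (c * \<rho> ^ t) + (\<Sum>r\<in>{Suc r0..N}. f (r div 2))"
      by (simp add: sum.distrib)
    also have "real (card {Suc r0..N}) * (c * \<rho> ^ t) \<le> C * real t * (c * \<rho> ^ t)"
      by (rule mult_right_mono) (use N c \<rho> in auto)
    also have "(\<Sum>r\<in>{Suc r0..N}. f (r div 2)) \<le> (\<Sum>i. f ((i + r0) div 2))"
    proof -
      have "(\<Sum>r\<in>{Suc r0..N}. f (r div 2)) \<le> (\<Sum>r\<in>{r0..<r0 + Suc N}. f (r div 2))"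
        by (rule sum_mono2) (use f_nonneg in auto)
      also have "\<dots> = (\<Sum>i<Suc N. f ((i + r0) div 2))"
        using sum.shift_bounds_nat_ivl[of "\<lambda>r. f (r div 2)" 0 r0 "Suc N"]
        by (simp add: lessThan_atLeast0 add.commute)
      also have "\<dots> \<le> (\<Sum>i. f ((i + r0) div 2))"
        by (rule sum_le_suminf) (use sf f_nonneg in \<open>auto simp: summable_iff_shift[of "\<lambda>n. f (n div 2)"]\<close>)
      finally show ?thesis .
    qed
    finally have "(\<Sum>r=1..N. repeat_prob r t) \<le> (\<Sum>r\<in>{1..<Suc r0}. repeat_prob r t)
        + (C * c * (real t * \<rho> ^ t) + (\<Sum>i. f ((i + r0) div 2)))"
      by (simp only: mult_ac add_left_mono add_mono)
    moreover have "(\<Sum>i. f ((i + r0) div 2)) < \<epsilon> / 3"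
      using r0[of r0] by simp
    ultimately show "(\<Sum>r=1..N. repeat_prob r t) \<le> \<epsilon>"
      using t0[OF t] by linarith
  qed
qed

end

subsection \<open>A lower bound on the information of long words\<close>

text \<open>Every distance to \<open>c\<close> is attained at most once on each side of
  \<open>c\<close>. This is the source of the factor 2 in the final bound.\<close>

lemma sum_abs_diff_le:
  fixes g :: "nat \<Rightarrow> real" and A :: "int set"
  assumes "finite A" and A: "\<And>a. a \<in> A \<Longrightarrow> \<bar>a - c\<bar> < int N" and g: "\<And>n. 0 \<le> g n"
  shows "(\<Sum>a\<in>A. g (nat \<bar>a - c\<bar>)) \<le> 2 * (\<Sum>n<N. g n)"
proof -
  have half: "(\<Sum>a\<in>B. g (nat \<bar>a - c\<bar>)) \<le> (\<Sum>n<N. g n)"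
    if "B \<subseteq> A" "inj_on (\<lambda>a. nat \<bar>a - c\<bar>) B" for B
  proof -
    have "(\<Sum>a\<in>B. g (nat \<bar>a - c\<bar>)) = (\<Sum>n\<in>(\<lambda>a. nat \<bar>a - c\<bar>) ` B. g n)"
      by (simp add: sum.reindex[OF that(2)])
    also have "\<dots> \<le> (\<Sum>n<N. g n)"
    proof (rule sum_mono2)
      show "(\<lambda>a. nat \<bar>a - c\<bar>) ` B \<subseteq> {..<N}"
        using A that(1) by (auto simp: nat_less_iff)
    qed (use g in auto)
    finally show ?thesis .
  qed
  have "(\<Sum>a\<in>A. g (nat \<bar>a - c\<bar>))
      = (\<Sum>a\<in>{a\<in>A. c \<le> a} \<union> {a\<in>A. a < c}. g (nat \<bar>a - c\<bar>))"
    by (rule sum.cong) auto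
  also have "\<dots> = (\<Sum>a\<in>{a\<in>A. c \<le> a}. g (nat \<bar>a - c\<bar>)) + (\<Sum>a\<in>{a\<in>A. a < c}. g (nat \<bar>a - c\<bar>))"
    by (rule sum.union_disjoint) (use \<open>finite A\<close> in auto)
  also have "\<dots> \<le> (\<Sum>n<N. g n) + (\<Sum>n<N. g n)"
    by (intro add_mono half) (auto simp: inj_on_def)
  finally show ?thesis by simp
qed

lemma sum_blocks_append:
  "(\<Sum>w\<in>blocks (L + m). f w) = (\<Sum>u\<in>blocks L. \<Sum>v\<in>blocks m. f (u @ v))"
proof -
  have "(\<Sum>u\<in>blocks L. \<Sum>v\<in>blocks m. f (u @ v)) = (\<Sum>(u, v)\<in>blocks L \<times> blocks m. f (u @ v))"
    by (simp add: sum.cartesian_product)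
  also have "\<dots> = (\<Sum>w\<in>blocks (L + m). f w)"
    by (rule sum.reindex_bij_witness[where i = "\<lambda>w. (take L w, drop L w)" and j = "\<lambda>(u, v). u @ v"])
      (auto simp: blocks_def)
  finally show ?thesis by simp
qed

section \<open>Block entropy and comparison with the product of block marginals\<close>

context stationary_process
begin

definition block_entropy :: "real \<Rightarrow> nat \<Rightarrow> real" where
  "block_entropy b m = - (\<Sum>w\<in>blocks m. word_prob w * log b (word_prob w))"

lemma block_entropy_nonneg: "1 < b \<Longrightarrow> 0 \<le> block_entropy b m"
  unfolding block_entropy_def neg_0_le_iff_le
proof (rule sum_nonpos)
  fix w :: "'a list" assume "1 < b"
  show "word_prob w * log b (word_prob w) \<le> 0"
  proof (cases "word_prob w = 0")
    case False
    then have "0 < word_prob w" by (simp add: less_le)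
    then have "log b (word_prob w) \<le> 0" using \<open>1 < b\<close> by (simp add: log_le_zero_cancel_iff)
    then show ?thesis by (simp add: mult_nonneg_nonpos)
  qed simp
qed

text \<open>The law under which \<open>K\<close> consecutive blocks of length \<open>L\<close> are
  independent, each with its true marginal.\<close>

fun product_prob :: "nat \<Rightarrow> nat \<Rightarrow> 'a list \<Rightarrow> real" where
  "product_prob L 0 w = 1"
| "product_prob L (Suc K) w = word_prob (take L w) * product_prob L K (drop L w)"

lemma sum_product_prob: "(\<Sum>w\<in>blocks (K * L). product_prob L K w) = 1"
proof (induction K)
  case 0
  have "blocks 0 = {[] :: 'a list}" by (auto simp: blocks_def)
  then show ?case by simp
next
  case (Suc K)
  have "(\<Sum>w\<in>blocks (Suc K * L). product_prob L (Suc K) w)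
      = (\<Sum>u\<in>blocks L. \<Sum>v\<in>blocks (K * L). word_prob u * product_prob L K v)"
    unfolding mult_Suc sum_blocks_append by (intro sum.cong) (auto simp: blocks_def)
  then show ?case using Suc.IH by (simp flip: sum_distrib_left)
qed

lemma product_prob_nonneg: "0 \<le> product_prob L K w"
  by (induction K arbitrary: w) auto

lemma product_prob_read:
  "product_prob L K (read (K * L) x i) = (\<Prod>k<K. word_prob (read L x (i + int (k * L))))"
proof (induction K arbitrary: i)
  case (Suc K)
  have "product_prob L (Suc K) (read (Suc K * L) x i)
      = word_prob (read L x i) * product_prob L K (read (K * L) x (i + int L))"
    by (simp add: take_read drop_read)
  also have "\<dots> = (\<Prod>k<Suc K. word_prob (read L x (i + int (k * L))))"
    unfolding Suc.IH prod.lessThan_Suc_shift by (simp add: algebra_simps)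
  finally show ?case .
qed simp

text \<open>The finitely many null words together have probability 0. Almost surely, then, all
  logarithms below are taken at positive arguments.\<close>

lemma AE_word_prob_pos: "AE x in P. 0 < word_prob (read m x i)"
proof -
  have "prob {x. \<not> 0 < word_prob (read m x i)} = 0"
  proof -
    have "prob {x. \<not> 0 < word_prob (read m x i)}
        = (\<Sum>w\<in>blocks m. prob ({x. \<not> 0 < word_prob (read m x i)} \<inter> {x. read m x i = w}))"
      by (rule prob_read_sum) (rule read_event)
    also have "\<dots> = 0"
    proof (intro sum.neutral ballI)
      fix w :: "'a list" assume w: "w \<in> blocks m"
      have "prob ({x. \<not> 0 < word_prob (read m x i)} \<inter> {x. read m x i = w})
          \<le> (if word_prob w \<le> 0 then prob {x. read m x i = w} else 0)"
      proof (cases "word_prob w \<le> 0")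
        case True
        then show ?thesis by (auto intro!: finite_measure_mono read_event)
      next
        case False
        then have "{x. \<not> 0 < word_prob (read m x i)} \<inter> {x. read m x i = w} = {}" by auto
        then show ?thesis by simp
      qed
      also have "\<dots> \<le> 0" using prob_read_eq[OF w] by simp
      finally show "prob ({x. \<not> 0 < word_prob (read m x i)} \<inter> {x. read m x i = w}) = 0"
        by (simp add: measure_le_0_iff)
    qed
    finally show ?thesis by simp
  qed
  then show ?thesis
    by (subst AE_iff_measurable[OF read_event[of "\<lambda>w. \<not> 0 < word_prob w" m i]])
      (auto simp: emeasure_eq_measure)
qed

lemma expectation_information:
  "expectation (\<lambda>x. - log b (word_prob (read m x i))) = block_entropy b m"
  using expectation_read[of "\<lambda>w. - log b (word_prob w)" m i]
  by (simp add: block_entropy_def sum_negf)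

text \<open>Markov's inequality for the positive part of \<open>D = log (P / Q)\<close>, where \<open>Q\<close> is the product of
  the block marginals: the mean of \<open>D\<close> is a relative entropy, and \<open>E [Q / P] \<le> 1\<close> bounds the mean
  of its negative part by \<open>1 / ln b\<close>.\<close>

lemma divergence_tail:
  assumes b: "1 < b" and "0 < c"
  shows "prob {x. (\<Sum>k<K. - log b (word_prob (read L x (int (k * L)))))
             + log b (word_prob (read (K * L) x 0)) \<ge> c}
    \<le> (real K * block_entropy b L - block_entropy b (K * L) + 1 / ln b) / c"
    (is "prob ?B \<le> _")
proof -
  let ?n = "K * L"
  define Y where "Y x = (\<Sum>k<K. - log b (word_prob (read L x (int (k * L)))))" for x
  define Z where "Z x = - log b (word_prob (read ?n x 0))" for x
  \<comment> \<open>The likelihood ratio of the product law to the true law, set to 0 on null words.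
    Its mean can fall short of 1 because the product law may charge such words.\<close>
  define g where "g w = (if 0 < word_prob w then product_prob L K w / word_prob w else 0)" for w
  have Y_int: "integrable P Y" unfolding Y_def
    by (intro Bochner_Integration.integrable_sum integrable_read)
  have Z_int: "integrable P Z" unfolding Z_def by (rule integrable_read)
  have g_int: "integrable P (\<lambda>x. g (read ?n x 0))" by (rule integrable_read)
  have EY: "expectation Y = real K * block_entropy b L"
    unfolding Y_def
    by (subst Bochner_Integration.integral_sum[OF integrable_read]) (simp only: expectation_information, simp)
  have EZ: "expectation Z = block_entropy b ?n"
    unfolding Z_def by (rule expectation_information)
  have Eg: "expectation (\<lambda>x. g (read ?n x 0)) \<le> 1"
  proof -
    have "expectation (\<lambda>x. g (read ?n x 0)) = (\<Sum>w\<in>blocks ?n. word_prob w * g w)"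
      by (rule expectation_read)
    also have "\<dots> \<le> (\<Sum>w\<in>blocks ?n. product_prob L K w)"
      by (rule sum_mono) (auto simp: g_def product_prob_nonneg)
    finally show ?thesis by (simp add: sum_product_prob)
  qed
  have pos: "AE x in P. \<forall>k\<in>{..<K}. 0 < word_prob (read L x (int (k * L)))"
    by (intro AE_finite_allI) (auto intro: AE_word_prob_pos)
  have B: "?B \<in> sets P"
  proof -
    have "(\<lambda>x. Y x - Z x) \<in> borel_measurable P" using Y_int Z_int by measurable
    then have "{x \<in> space P. c \<le> Y x - Z x} \<in> sets P" by measurable
    then show ?thesis by (simp add: Y_def Z_def)
  qed
  have "prob ?B = expectation (indicator ?B)"
    using B by simp
  \<comment> \<open>Almost surely \<open>Y x - Z x = - ln (Q / p) / ln b\<close>. As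
    \<open>ln y \<le> y\<close>, adding \<open>g / ln b\<close> makes this nonnegative, and Markov's
    argument applies pointwise.\<close>
  also have "\<dots> \<le> expectation (\<lambda>x. (Y x - Z x + g (read ?n x 0) / ln b) / c)"
  proof (rule integral_mono_AE)
    show "integrable P (indicator ?B :: _ \<Rightarrow> real)"
      using B by (intro integrable_real_indicator) (auto simp: emeasure_eq_measure)
    show "integrable P (\<lambda>x. (Y x - Z x + g (read ?n x 0) / ln b) / c)"
      using Y_int Z_int g_int by simp
    show "AE x in P. indicat_real ?B x \<le> (Y x - Z x + g (read ?n x 0) / ln b) / c"
      using pos AE_word_prob_pos[of ?n 0]
    proof eventually_elim
      fix x
      assume p: "\<forall>k\<in>{..<K}. 0 < word_prob (read L x (int (k * L)))" and pn: "0 < word_prob (read ?n x 0)"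
      let ?Q = "product_prob L K (read ?n x 0)" and ?p = "word_prob (read ?n x 0)"
      have Q: "?Q = (\<Prod>k<K. word_prob (read L x (int (k * L))))"
        using product_prob_read[of L K x 0] by simp
      have Qpos: "0 < ?Q" unfolding Q using p by (intro prod_pos) auto
      have "Y x = - log b ?Q"
      proof -
        have "ln ?Q = (\<Sum>k<K. ln (word_prob (read L x (int (k * L)))))"
          unfolding Q by (rule ln_prod) (use p in \<open>auto dest!: bspec simp del: of_nat_mult\<close>)
        then show ?thesis
          unfolding Y_def log_def by (simp add: sum_negf sum_divide_distrib)
      qed
      then have D: "Y x - Z x = - (ln (?Q / ?p) / ln b)"
        using Qpos pn by (simp add: Z_def log_def ln_div diff_divide_distrib)
      have "ln (?Q / ?p) \<le> ?Q / ?p"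
        using ln_le_minus_one[of "?Q / ?p"] Qpos pn by simp
      then have "ln (?Q / ?p) / ln b \<le> g (read ?n x 0) / ln b"
        using b pn by (intro divide_right_mono) (auto simp: g_def)
      then have nonneg: "0 \<le> Y x - Z x + g (read ?n x 0) / ln b"
        using D by simp
      have "0 \<le> g (read ?n x 0) / ln b"
        using b pn Qpos by (simp add: g_def)
      then have "c \<le> Y x - Z x + g (read ?n x 0) / ln b" if "x \<in> ?B"
        using that by (simp add: Y_def Z_def)
      then show "indicat_real ?B x \<le> (Y x - Z x + g (read ?n x 0) / ln b) / c"
        using nonneg \<open>0 < c\<close> by (auto simp: indicator_def)
    qed
  qed
  also have "\<dots> = (real K * block_entropy b L - block_entropy b ?n + expectation (\<lambda>x. g (read ?n x 0)) / ln b) / c"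
    using Y_int Z_int g_int by (simp add: EY EZ)
  also have "\<dots> \<le> (real K * block_entropy b L - block_entropy b (K * L) + 1 / ln b) / c"
    using Eg b \<open>0 < c\<close> by (intro divide_right_mono add_left_mono) auto
  finally show ?thesis .
qed

section \<open>Covariances of functions of two reads\<close>

lemma read_bounded:
  fixes x :: "int \<Rightarrow> 'a"
  shows "\<bar>f (read m x i) :: real\<bar> \<le> (\<Sum>w\<in>blocks m. \<bar>f w\<bar>)"
  by (rule member_le_sum) auto

lemma integrable_read2: "integrable P (\<lambda>x. f (read m x u) * g (read m x v) :: real)"
proof (rule integrable_const_bound[where B = "(\<Sum>w\<in>blocks m. \<bar>f w\<bar>) * (\<Sum>w\<in>blocks m. \<bar>g w\<bar>)"])
  show "AE x in P. norm (f (read m x u) * g (read m x v))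
      \<le> (\<Sum>w\<in>blocks m. \<bar>f w\<bar>) * (\<Sum>w\<in>blocks m. \<bar>g w\<bar>)"
    by (auto simp: abs_mult intro!: AE_I2 mult_mono read_bounded[of f] read_bounded[of g] sum_nonneg)
qed measurable

lemma expectation_read2:
  "expectation (\<lambda>x. f (read m x u) * g (read m x v))
    = (\<Sum>a\<in>blocks m. \<Sum>b\<in>blocks m. f a * g b * prob ({x. read m x u = a} \<inter> {x. read m x v = b}))"
proof -
  let ?I = "\<lambda>a b. indicat_real ({x. read m x u = a} \<inter> {x. read m x v = b})"
  have "f (read m x u) * g (read m x v) = (\<Sum>a\<in>blocks m. \<Sum>b\<in>blocks m. f a * g b * ?I a b x)" for x
    by (subst (1 2) sum_read_indicator[symmetric])
      (simp add: sum_product indicator_inter_arith mult_ac)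
  then have "expectation (\<lambda>x. f (read m x u) * g (read m x v))
      = expectation (\<lambda>x. \<Sum>a\<in>blocks m. \<Sum>b\<in>blocks m. f a * g b * ?I a b x)"
    by (simp only:)
  also have "\<dots> = (\<Sum>a\<in>blocks m. \<Sum>b\<in>blocks m. f a * g b * prob ({x. read m x u = a} \<inter> {x. read m x v = b}))"
  proof -
    have ev: "{x. read m x u = a} \<inter> {x. read m x v = b} \<in> sets P" for a b
      by (intro sets.Int read_event)
    have I: "integrable P (\<lambda>x. f a * g b * ?I a b x)" for a b
      by (intro integrable_mult_right integrable_real_indicator ev) (simp add: emeasure_eq_measure)
    have "expectation (\<lambda>x. \<Sum>b\<in>blocks m. f a * g b * ?I a b x)
        = (\<Sum>b\<in>blocks m. f a * g b * prob ({x. read m x u = a} \<inter> {x. read m x v = b}))" for a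
      by (subst Bochner_Integration.integral_sum, rule I) (use ev in simp)
    then show ?thesis
      by (subst Bochner_Integration.integral_sum, intro Bochner_Integration.integrable_sum I) simp
  qed
  finally show ?thesis .
qed

text \<open>For centred \<open>f\<close> the product of the marginals contributes 0. What remains is
  the deviation of the joint law from that product, at most \<open>mix s\<close> for each pair of
  words.\<close>

lemma covariance_read_le:
  assumes mean: "(\<Sum>w\<in>blocks m. word_prob w * f w) = 0" and gap: "u + int m - 1 + int s \<le> v"
  shows "expectation (\<lambda>x. f (read m x u) * f (read m x v)) \<le> (\<Sum>w\<in>blocks m. \<bar>f w\<bar>)\<^sup>2 * mix s"
proof -
  let ?p = "\<lambda>a b. prob ({x. read m x u = a} \<inter> {x. read m x v = b})"
  have zero: "(\<Sum>a\<in>blocks m. \<Sum>b\<in>blocks m. f a * f b * (word_prob a * word_prob b)) = 0"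
  proof -
    have "(\<Sum>a\<in>blocks m. \<Sum>b\<in>blocks m. f a * f b * (word_prob a * word_prob b))
        = (\<Sum>a\<in>blocks m. \<Sum>b\<in>blocks m. (word_prob a * f a) * (word_prob b * f b))"
      by (simp add: mult_ac)
    also have "\<dots> = (\<Sum>a\<in>blocks m. word_prob a * f a) * (\<Sum>b\<in>blocks m. word_prob b * f b)"
      by (simp only: sum_product)
    finally show ?thesis using mean by simp
  qed
  have "expectation (\<lambda>x. f (read m x u) * f (read m x v))
      = (\<Sum>a\<in>blocks m. \<Sum>b\<in>blocks m. f a * f b * (?p a b - word_prob a * word_prob b))"
    unfolding expectation_read2 using zero by (simp add: right_diff_distrib sum_subtractf)
  also have "\<dots> \<le> (\<Sum>a\<in>blocks m. \<Sum>b\<in>blocks m. \<bar>f a\<bar> * \<bar>f b\<bar> * mix s)"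
  proof (intro sum_mono)
    fix a b :: "'a list" assume ab: "a \<in> blocks m" "b \<in> blocks m"
    have "\<bar>?p a b - prob {x. read m x u = a} * prob {x. read m x v = b}\<bar> \<le> prob {x. read m x u = a} * mix s"
      by (rule prob_inter_mix[where i = "u + int m - 1" and J = "{u..<u + int m}" and J' = "{v..<v + int m}"])
        (use gap in \<open>auto intro!: read_event_sigma_on\<close>)
    also have "\<dots> \<le> 1 * mix s"
      by (intro mult_right_mono mix_nonneg) simp
    finally have "\<bar>?p a b - word_prob a * word_prob b\<bar> \<le> mix s"
      using ab by (simp add: prob_read_eq)
    then have "\<bar>f a * f b\<bar> * \<bar>?p a b - word_prob a * word_prob b\<bar> \<le> \<bar>f a * f b\<bar> * mix s"
      by (intro mult_left_mono) auto
    then show "f a * f b * (?p a b - word_prob a * word_prob b) \<le> \<bar>f a\<bar> * \<bar>f b\<bar> * mix s"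
      unfolding abs_mult[symmetric] by (rule order_trans[OF abs_ge_self])
  qed
  also have "\<dots> = (\<Sum>w\<in>blocks m. \<bar>f w\<bar>)\<^sup>2 * mix s"
    by (simp add: power2_eq_square sum_product flip: sum_distrib_right)
  finally show ?thesis .
qed

end

section \<open>Weak law for block information and the equipartition bound\<close>

context mixing_process
begin

text \<open>Covariances of blocks \<open>r\<close> steps apart are at most a constant times
  \<open>mix r\<close>, which is summable, so the variance grows only linearly in the number of
  blocks.\<close>

lemma variance_sum_read_le:
  assumes mean: "(\<Sum>w\<in>blocks m. word_prob w * f w) = 0" and "1 \<le> m"
  obtains B where "\<And>K. expectation (\<lambda>x. (\<Sum>k<K. f (read m x (int (k * m))))\<^sup>2) \<le> B * real K"
proof -
  define C where "C = (\<Sum>w\<in>blocks m. \<bar>f w\<bar>)\<^sup>2"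
  \<comment> \<open>The diagonal is not controlled by mixing and is bounded by the constant
    \<open>C\<close> alone.\<close>
  define c where "c r = (if r = 0 then C else C * mix r)" for r
  have "0 \<le> C" by (simp add: C_def)
  then have c_nonneg: "0 \<le> c r" for r by (simp add: c_def mix_nonneg)
  have "summable (\<lambda>r. C * mix r)" by (intro summable_mult mix_summable)
  then have "summable c"
    by (subst summable_cong[where g = "\<lambda>r. C * mix r"])
      (auto simp: c_def eventually_sequentially intro!: exI[of _ 1])
  let ?F = "\<lambda>k x. f (read m x (int (k * m)))"
  have less: "expectation (\<lambda>x. ?F j x * ?F k x) \<le> c (nat \<bar>int j - int k\<bar>)" if "j < k" for j k
  proof -
    define r where "r = k - j"
    have r: "k = j + r" "1 \<le> r" using that by (auto simp: r_def)
    \<comment> \<open>The last letter of one block and the first letter of the block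
      \<open>r\<close> steps later are \<open>(r - 1) * m + 1\<close> apart, which is at least
      \<open>r\<close>.\<close>
    have "int m - 1 + int r \<le> int r * int m"
    proof -
      have "0 \<le> (int r - 1) * (int m - 1)" using r \<open>1 \<le> m\<close> by (intro mult_nonneg_nonneg) auto
      then show ?thesis by (simp add: algebra_simps)
    qed
    then have "expectation (\<lambda>x. ?F j x * ?F k x) \<le> (\<Sum>w\<in>blocks m. \<bar>f w\<bar>)\<^sup>2 * mix r"
      by (intro covariance_read_le mean) (simp add: r(1) algebra_simps)
    then show ?thesis using r by (simp add: c_def C_def)
  qed
  have cov: "expectation (\<lambda>x. ?F j x * ?F k x) \<le> c (nat \<bar>int j - int k\<bar>)" for j k
  proof (rule linorder_cases[of j k])
    assume "j = k"
    have "expectation (\<lambda>x. ?F j x * ?F j x) = (\<Sum>w\<in>blocks m. word_prob w * (f w * f w))"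
      by (rule expectation_read[of "\<lambda>w. f w * f w"])
    also have "\<dots> \<le> (\<Sum>w\<in>blocks m. \<bar>f w\<bar> * (\<Sum>w\<in>blocks m. \<bar>f w\<bar>))"
    proof (rule sum_mono)
      fix w :: "'a list" assume "w \<in> blocks m"
      have "word_prob w * (f w * f w) \<le> f w * f w"
        using mult_right_mono[OF word_prob_le_1[of w], of "f w * f w"] by simp
      also have "\<dots> = \<bar>f w\<bar> * \<bar>f w\<bar>" by simp
      also have "\<dots> \<le> \<bar>f w\<bar> * (\<Sum>w\<in>blocks m. \<bar>f w\<bar>)"
        using \<open>w \<in> blocks m\<close> by (intro mult_left_mono member_le_sum) auto
      finally show "word_prob w * (f w * f w) \<le> \<bar>f w\<bar> * (\<Sum>w\<in>blocks m. \<bar>f w\<bar>)" .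
    qed
    also have "\<dots> = C" by (simp add: C_def power2_eq_square sum_distrib_right)
    finally show ?thesis using \<open>j = k\<close> by (simp add: c_def)
  next
    assume "j < k"
    then show ?thesis by (rule less)
  next
    assume "k < j"
    then show ?thesis using less[of k j] by (simp add: mult.commute abs_minus_commute)
  qed
  show ?thesis
  proof (rule that)
    fix K
    have int: "integrable P (\<lambda>x. ?F j x * ?F k x)" for j k
      by (rule integrable_read2)
    have "expectation (\<lambda>x. (\<Sum>k<K. ?F k x)\<^sup>2) = expectation (\<lambda>x. \<Sum>j<K. \<Sum>k<K. ?F j x * ?F k x)"
      by (simp add: power2_eq_square sum_product)
    also have "\<dots> = (\<Sum>j<K. \<Sum>k<K. expectation (\<lambda>x. ?F j x * ?F k x))"
      by (subst Bochner_Integration.integral_sum, intro Bochner_Integration.integrable_sum int)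
        (intro sum.cong refl Bochner_Integration.integral_sum int)
    also have "\<dots> \<le> (\<Sum>j<K. \<Sum>k<K. c (nat \<bar>int j - int k\<bar>))"
      by (intro sum_mono cov)
    also have "\<dots> \<le> (\<Sum>j<K. 2 * suminf c)"
    proof (rule sum_mono)
      fix j assume "j \<in> {..<K}"
      have "(\<Sum>k<K. c (nat \<bar>int j - int k\<bar>)) = (\<Sum>a\<in>int ` {..<K}. c (nat \<bar>a - int j\<bar>))"
        by (simp add: sum.reindex abs_minus_commute)
      also have "\<dots> \<le> 2 * (\<Sum>n<K. c n)"
        by (rule sum_abs_diff_le) (use \<open>j \<in> {..<K}\<close> c_nonneg in auto)
      also have "\<dots> \<le> 2 * suminf c"
        using sum_le_suminf[OF \<open>summable c\<close>, of "{..<K}"] c_nonneg by simp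
      finally show "(\<Sum>k<K. c (nat \<bar>int j - int k\<bar>)) \<le> 2 * suminf c" .
    qed
    also have "\<dots> = 2 * suminf c * real K" by simp
    finally show "expectation (\<lambda>x. (\<Sum>k<K. ?F k x)\<^sup>2) \<le> 2 * suminf c * real K" .
  qed
qed

text \<open>Compare the information \<open>Z\<close> of the long word with the sum \<open>Y\<close>
  of its block informations. If \<open>Z\<close> falls \<open>c\<close> below the mean of
  \<open>Y\<close>, then \<open>Y - Z\<close> or the deviation of \<open>Y\<close> from its mean is
  at least \<open>c / 2\<close>; \<open>divergence_tail\<close> handles the first and Chebyshev's
  inequality the second. \<open>B\<close> depends neither on \<open>K\<close> nor on
  \<open>c\<close>.\<close>

lemma block_aep_bound:
  assumes b: "1 < b" and "1 \<le> L"
  obtains B where "0 \<le> B" "\<And>K c. 0 < c \<Longrightarrow>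
    prob {x. - log b (word_prob (read (K * L) x 0)) < real K * block_entropy b L - c}
    \<le> 2 * (real K * block_entropy b L - block_entropy b (K * L) + 1 / ln b) / c + 4 * B * real K / c\<^sup>2"
proof -
  let ?h = "block_entropy b L"
  define f where "f w = - log b (word_prob w) - ?h" for w
  have mean: "(\<Sum>w\<in>blocks L. word_prob w * f w) = 0"
    unfolding f_def
    by (simp add: right_diff_distrib sum_subtractf block_entropy_def sum_negf flip: sum_distrib_right)
  obtain B where B: "\<And>K. expectation (\<lambda>x. (\<Sum>k<K. f (read L x (int (k * L))))\<^sup>2) \<le> B * real K"
    using variance_sum_read_le[OF mean \<open>1 \<le> L\<close>] by blast
  show ?thesis
  proof (rule that)
    have "0 \<le> expectation (\<lambda>x. (\<Sum>k<1. f (read L x (int (k * L))))\<^sup>2)"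
      by (rule Bochner_Integration.integral_nonneg) simp
    from order_trans[OF this B[of 1]] show "0 \<le> B" by simp
  next
    fix K :: nat and c :: real assume "0 < c"
    define Y where "Y x = (\<Sum>k<K. - log b (word_prob (read L x (int (k * L)))))" for x
    define Z where "Z x = - log b (word_prob (read (K * L) x 0))" for x
    have Ymeas [measurable]: "Y \<in> borel_measurable P" unfolding Y_def by measurable
    have Zmeas [measurable]: "Z \<in> borel_measurable P" unfolding Z_def by measurable
    have dev: "(\<Sum>k<K. f (read L x (int (k * L)))) = Y x - real K * ?h" for x
      by (simp add: f_def Y_def sum_subtractf)
    have sets: "{x. c / 2 \<le> Y x - Z x} \<in> sets P" "{x. c / 2 \<le> \<bar>Y x - real K * ?h\<bar>} \<in> sets P"
    proof -
      have "{x \<in> space P. c / 2 \<le> Y x - Z x} \<in> sets P" by measurable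
      then show "{x. c / 2 \<le> Y x - Z x} \<in> sets P" by simp
      have "{x \<in> space P. c / 2 \<le> \<bar>Y x - real K * ?h\<bar>} \<in> sets P" by measurable
      then show "{x. c / 2 \<le> \<bar>Y x - real K * ?h\<bar>} \<in> sets P" by simp
    qed
    have "prob {x. Z x < real K * ?h - c}
        \<le> prob ({x. c / 2 \<le> Y x - Z x} \<union> {x. c / 2 \<le> \<bar>Y x - real K * ?h\<bar>})"
    proof (rule finite_measure_mono)
      show "{x. Z x < real K * ?h - c} \<subseteq> {x. c / 2 \<le> Y x - Z x} \<union> {x. c / 2 \<le> \<bar>Y x - real K * ?h\<bar>}"
        by (auto simp: not_le abs_if split: if_splits)
    qed (use sets in auto)
    also have "\<dots> \<le> prob {x. c / 2 \<le> Y x - Z x} + prob {x. c / 2 \<le> \<bar>Y x - real K * ?h\<bar>}"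
      by (rule measure_Un_le) (use sets in auto)
    also have "prob {x. c / 2 \<le> Y x - Z x}
        \<le> (real K * ?h - block_entropy b (K * L) + 1 / ln b) / (c / 2)"
      using divergence_tail[OF b, where c = "c / 2" and K = K and L = L] \<open>0 < c\<close> by (simp add: Y_def Z_def)
    also have "prob {x. c / 2 \<le> \<bar>Y x - real K * ?h\<bar>} \<le> B * real K / (c / 2)\<^sup>2"
    proof -
      let ?X = "\<lambda>x. (Y x - real K * ?h)\<^sup>2"
      have int: "integrable P ?X"
        unfolding dev[symmetric] power2_eq_square sum_product
        by (intro Bochner_Integration.integrable_sum integrable_read2)
      have eq: "{x \<in> space P. (c / 2)\<^sup>2 \<le> ?X x} = {x. c / 2 \<le> \<bar>Y x - real K * ?h\<bar>}"
        using \<open>0 < c\<close> abs_le_square_iff[of "c / 2"] by auto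
      have "prob {x \<in> space P. (c / 2)\<^sup>2 \<le> ?X x} \<le> expectation ?X / (c / 2)\<^sup>2"
        by (rule integral_Markov_inequality_measure[OF int, where A = UNIV])
          (use \<open>0 < c\<close> sets.top[of P] in auto)
      also have "\<dots> \<le> B * real K / (c / 2)\<^sup>2"
        using divide_right_mono[OF B[of K], of "(c / 2)\<^sup>2"] unfolding dev by simp
      finally show ?thesis by (simp only: eq)
    qed
    finally show "prob {x. - log b (word_prob (read (K * L) x 0)) < real K * ?h - c}
        \<le> 2 * (real K * ?h - block_entropy b (K * L) + 1 / ln b) / c + 4 * B * real K / c\<^sup>2"
      by (simp add: Z_def power_divide mult_ac)
  qed
qed

text \<open>The probability estimate is first obtained along odd multiples of a fixed odd block length,
  since the entropy rate is only given along odd lengths.\<close>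

lemma aep_lower:
  assumes b: "1 < b" and "0 < \<delta>" and H: "0 \<le> H"
    and lim: "(\<lambda>t. block_entropy b (2 * t + 1) / real (2 * t + 1)) \<longlonglongrightarrow> H"
  shows "(\<lambda>t. prob {x. b powr (- (real t * (H - \<delta>))) < word_prob (read t x 0)}) \<longlonglongrightarrow> 0"
proof (rule LIMSEQ_I)
  fix \<epsilon> :: real assume "0 < \<epsilon>"
  \<comment> \<open>Below \<open>c = n * \<delta> / 4\<close> with \<open>n = K * L\<close>. The
    bound \<open>\<delta> / 4\<close> keeps the threshold within reach of \<open>c\<close>; the
    bound \<open>\<delta> * \<epsilon> / 48\<close> makes the divergence term
    \<open>4 * n * \<eta> / c\<close> at most \<open>\<epsilon> / 3\<close>.\<close>
  define \<eta> where "\<eta> = min (\<delta> / 4) (\<delta> * \<epsilon> / 48)"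
  have \<eta>: "0 < \<eta>" "\<eta> \<le> \<delta> / 4" "\<eta> \<le> \<delta> * \<epsilon> / 48"
    using \<open>0 < \<delta>\<close> \<open>0 < \<epsilon>\<close> by (auto simp: \<eta>_def)
  obtain t1 where t1: "\<And>t. t \<ge> t1 \<Longrightarrow> \<bar>block_entropy b (2 * t + 1) / real (2 * t + 1) - H\<bar> < \<eta>"
    using LIMSEQ_D[OF lim \<eta>(1)] by auto
  \<comment> \<open>\<open>L\<close> is odd, so \<open>K * L\<close> is odd whenever
    \<open>K\<close> is, and \<open>rate\<close> covers both lengths.\<close>
  define L where "L = 2 * t1 + 1"
  have L: "1 \<le> L" "odd L" by (auto simp: L_def)
  have rate: "real m * (H - \<eta>) \<le> block_entropy b m" "block_entropy b m \<le> real m * (H + \<eta>)"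
    if "odd m" "L \<le> m" for m
  proof -
    obtain t where t: "m = 2 * t + 1" using \<open>odd m\<close> by (elim oddE)
    with that have "t1 \<le> t" by (simp add: L_def)
    then have "\<bar>block_entropy b m / real m - H\<bar> < \<eta>" using t1 t by simp
    then have "H - \<eta> \<le> block_entropy b m / real m" "block_entropy b m / real m \<le> H + \<eta>"
      by (auto simp: abs_less_iff)
    moreover have "0 < real m" using t by simp
    ultimately show "real m * (H - \<eta>) \<le> block_entropy b m" "block_entropy b m \<le> real m * (H + \<eta>)"
      by (auto simp: field_simps)
  qed
  obtain B where B0: "0 \<le> B" and B: "\<And>K c. 0 < c \<Longrightarrow>
      prob {x. - log b (word_prob (read (K * L) x 0)) < real K * block_entropy b L - c}
      \<le> 2 * (real K * block_entropy b L - block_entropy b (K * L) + 1 / ln b) / c + 4 * B * real K / c\<^sup>2"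
    using block_aep_bound[OF b L(1)] by blast
  \<comment> \<open>The coefficients of \<open>1 / real K\<close> left over from
    \<open>1 / ln b\<close> and from the Chebyshev term.\<close>
  define A where "A = 8 / (ln b * \<delta>) + 64 * B / \<delta>\<^sup>2"
  have odd_bound: "prob {x. - log b (word_prob (read (K * L) x 0)) < real (K * L) * (H - \<delta> / 2)}
      \<le> \<epsilon> / 3 + A / real K" if "odd K" for K
  proof -
    let ?n = "real (K * L)"
    have K: "1 \<le> K" using \<open>odd K\<close> by (cases K) auto
    then have n: "0 < ?n" "real K \<le> ?n" using L by auto
    have hL: "real L * (H - \<eta>) \<le> block_entropy b L" "block_entropy b L \<le> real L * (H + \<eta>)"
      using rate[of L] L by auto
    have hn: "?n * (H - \<eta>) \<le> block_entropy b (K * L)"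
      using rate(1)[of "K * L"] \<open>odd K\<close> L K by simp
    have KhL: "?n * (H - \<eta>) \<le> real K * block_entropy b L" "real K * block_entropy b L \<le> ?n * (H + \<eta>)"
      using mult_left_mono[OF hL(1), of "real K"] mult_left_mono[OF hL(2), of "real K"]
      by (auto simp: mult_ac)
    define c where "c = ?n * \<delta> / 4"
    have c: "0 < c" using n \<open>0 < \<delta>\<close> by (simp add: c_def)
    have "?n * (H - \<delta> / 2) \<le> real K * block_entropy b L - c"
    proof -
      have "?n * \<eta> \<le> ?n * (\<delta> / 4)" using \<eta> n by (intro mult_left_mono) auto
      with KhL(1) show ?thesis by (simp add: c_def algebra_simps)
    qed
    then have "prob {x. - log b (word_prob (read (K * L) x 0)) < ?n * (H - \<delta> / 2)}
        \<le> prob {x. - log b (word_prob (read (K * L) x 0)) < real K * block_entropy b L - c}"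
      by (intro finite_measure_mono read_event) auto
    also have "\<dots> \<le> 2 * (real K * block_entropy b L - block_entropy b (K * L) + 1 / ln b) / c
        + 4 * B * real K / c\<^sup>2"
      by (rule B[OF c])
    also have "\<dots> \<le> \<epsilon> / 3 + A / real K"
    proof -
      have "real K * block_entropy b L - block_entropy b (K * L) \<le> 2 * (?n * \<eta>)"
        using KhL(2) hn by (simp add: algebra_simps)
      also have "\<dots> \<le> 2 * (?n * (\<delta> * \<epsilon> / 48))"
        using \<eta> n by (intro mult_left_mono) auto
      finally have *: "real K * block_entropy b L - block_entropy b (K * L) \<le> c * \<epsilon> / 6"
        by (simp add: c_def mult_ac)
      have "2 * (real K * block_entropy b L - block_entropy b (K * L) + 1 / ln b) / c
          \<le> 2 * (c * \<epsilon> / 6 + 1 / ln b) / c"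
        using c by (intro divide_right_mono mult_left_mono add_right_mono *) auto
      also have "\<dots> = \<epsilon> / 3 + 2 / (ln b * c)"
        using c b by (simp add: field_simps)
      also have "2 / (ln b * c) = 8 / (ln b * \<delta>) / ?n"
        by (simp add: c_def)
      also have "8 / (ln b * \<delta>) / ?n \<le> 8 / (ln b * \<delta>) / real K"
        using n b \<open>0 < \<delta>\<close> K by (intro divide_left_mono mult_pos_pos) auto
      finally have 1: "2 * (real K * block_entropy b L - block_entropy b (K * L) + 1 / ln b) / c
          \<le> \<epsilon> / 3 + 8 / (ln b * \<delta>) / real K" by simp
      have "real K * \<delta> / 4 \<le> c"
        using mult_right_mono[OF n(2), of \<delta>] \<open>0 < \<delta>\<close> by (simp add: c_def)
      then have "(real K * \<delta> / 4)\<^sup>2 \<le> c\<^sup>2" using \<open>0 < \<delta>\<close> by (intro power_mono) auto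
      then have "4 * B * real K / c\<^sup>2 \<le> 4 * B * real K / (real K * \<delta> / 4)\<^sup>2"
        using B0 K c \<open>0 < \<delta>\<close> by (intro divide_left_mono mult_pos_pos) auto
      also have "\<dots> = 64 * B / \<delta>\<^sup>2 / real K"
        using K by (simp add: power2_eq_square field_simps)
      finally show ?thesis using 1 by (simp add: A_def add_divide_distrib)
    qed
    finally show ?thesis .
  qed
  obtain K0 :: nat where K0: "3 * \<bar>A\<bar> / \<epsilon> < real K0" "1 \<le> K0"
  proof -
    obtain k :: nat where "3 * \<bar>A\<bar> / \<epsilon> < real k" using reals_Archimedean2 by blast
    then show ?thesis by (intro that[of "Suc k"]) auto
  qed
  \<comment> \<open>Cutting the word to length \<open>K * L\<close> loses at most
    \<open>2 * L\<close> letters; for \<open>t \<ge> T\<close> their cost \<open>2 * L * H\<close>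
    is at most \<open>t * \<delta> / 2\<close>.\<close>
  obtain T :: nat where T: "4 * real L * H / \<delta> < real T" using reals_Archimedean2 by blast
  show "\<exists>t0. \<forall>t\<ge>t0. norm (prob {x. b powr (- (real t * (H - \<delta>))) < word_prob (read t x 0)} - 0) < \<epsilon>"
  proof (intro exI allI impI)
    fix t assume t: "max T ((K0 + 2) * L) \<le> t"
    \<comment> \<open>The largest odd number not above \<open>t div L\<close>.\<close>
    define K where "K = (if odd (t div L) then t div L else t div L - 1)"
    have "K0 + 2 \<le> t div L"
      using t L by (simp add: less_eq_div_iff_mult_less_eq)
    then have K: "odd K" "K0 \<le> K" "t div L \<le> K + 1" "K \<le> t div L"
      by (auto simp: K_def)
    have n: "K * L \<le> t"
      using K(4) by (meson div_times_less_eq_dividend mult_right_mono order_trans zero_le)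
    have "t < (t div L + 1) * L"
      using L dividend_less_div_times[of L t] by simp
    also have "\<dots> \<le> (K + 2) * L" using K by (intro mult_right_mono) auto
    finally have tn: "real t \<le> real (K * L) + 2 * real L"
      unfolding of_nat_mult[symmetric] by (simp add: algebra_simps flip: of_nat_mult of_nat_add)
    have exponent: "real t * (H - \<delta>) \<le> real (K * L) * (H - \<delta> / 2)"
    proof -
      have "(real t - real (K * L)) * H \<le> 2 * real L * H"
        using tn H by (intro mult_right_mono) auto
      moreover have "4 * real L * H \<le> real t * \<delta>"
      proof -
        have "4 * real L * H \<le> real T * \<delta>" using T \<open>0 < \<delta>\<close> by (simp add: field_simps)
        also have "\<dots> \<le> real t * \<delta>" using t \<open>0 < \<delta>\<close> by simp
        finally show ?thesis .
      qed
      moreover have "real (K * L) * \<delta> \<le> real t * \<delta>"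
        using n \<open>0 < \<delta>\<close> by (intro mult_right_mono) (auto simp del: of_nat_mult)
      ultimately show ?thesis by (simp add: algebra_simps)
    qed
    have "prob {x. b powr (- (real t * (H - \<delta>))) < word_prob (read t x 0)}
        \<le> prob {x. - log b (word_prob (read (K * L) x 0)) < real (K * L) * (H - \<delta> / 2)}"
    proof (rule finite_measure_mono[OF subsetI read_event])
      fix x assume "x \<in> {x. b powr (- (real t * (H - \<delta>))) < word_prob (read t x 0)}"
      then have "b powr (- (real t * (H - \<delta>))) < word_prob (read t x 0)" by simp
      also have "\<dots> \<le> word_prob (read (K * L) x 0)"
        using word_prob_take_le[of "read t x 0" "K * L"] n by (simp add: take_read)
      finally have lt: "b powr (- (real t * (H - \<delta>))) < word_prob (read (K * L) x 0)" .
      then have "0 < word_prob (read (K * L) x 0)"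
        using powr_ge_zero[of b] by (rule le_less_trans[rotated])
      with lt have "- (real t * (H - \<delta>)) < log b (word_prob (read (K * L) x 0))"
        using b by (simp add: less_log_iff)
      then show "x \<in> {x. - log b (word_prob (read (K * L) x 0)) < real (K * L) * (H - \<delta> / 2)}"
        using exponent by simp
    qed
    also have "\<dots> \<le> \<epsilon> / 3 + A / real K" by (rule odd_bound[OF K(1)])
    also have "A / real K < \<epsilon> / 3"
    proof -
      have "3 * \<bar>A\<bar> < \<epsilon> * real K0" using K0 \<open>0 < \<epsilon>\<close> by (simp add: field_simps)
      also have "\<dots> \<le> \<epsilon> * real K" using K \<open>0 < \<epsilon>\<close> by simp
      finally show ?thesis using K K0 by (simp add: field_simps)
    qed
    finally show "norm (prob {x. b powr (- (real t * (H - \<delta>))) < word_prob (read t x 0)} - 0) < \<epsilon>"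
      using \<open>0 < \<epsilon>\<close> by simp
  qed
qed

end

subsection \<open>Detectors\<close>

lemma overlap_eq_0_iff: "overlap l i j = 0 \<longleftrightarrow> int l \<le> \<bar>j - i\<bar>"
  by (auto simp: overlap_def max_def)

lemma second_set_props:
  assumes "1 \<le> l" "2 * l \<le> n" "i \<in> {1..int n}"
  shows "finite (second_set n l i)" "card (second_set n l i) = n"
    "\<And>j. j \<in> second_set n l i \<Longrightarrow> \<bar>j - i\<bar> < int (n + 1)"
  using assms by (auto simp: second_set_def split: if_splits)

section \<open>Error probability as a sum over the distance of the reads\<close>

context stationary_process
begin

definition pair_error :: "nat \<Rightarrow> ('a list \<Rightarrow> 'a list \<Rightarrow> int) \<Rightarrow> int \<Rightarrow> int \<Rightarrow> real" where
  "pair_error l Th i j = prob {x. Th (read l x i) (read l x j) \<noteq> overlap l i j}"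

text \<open>Given the first index, the second is uniform on \<open>n\<close> integers, and each
  distance occurs at most twice among them. The average over pairs thus becomes \<open>2 / n\<close>
  times a sum over distances.\<close>

lemma error_prob_le:
  assumes l: "1 \<le> l" "2 * l \<le> n" and e: "\<And>k. 0 \<le> e k"
    and pair: "\<And>i j. pair_error l Th i j \<le> e (nat \<bar>j - i\<bar>)"
  shows "error_prob P n l Th \<le> 2 / real n * (\<Sum>k<n + 1. e k)"
proof -
  let ?M = "measure_pmf (index_pmf n l)"
  let ?A = "\<lambda>ij. {x. Th (read l x (fst ij)) (read l x (snd ij)) \<noteq> overlap l (fst ij) (snd ij)}"
  define S where "S = {(ij, x). ij \<in> (UNIV :: (int \<times> int) set) \<and> x \<in> space P \<and>
                 Th (read l x (fst ij)) (read l x (snd ij)) \<noteq> overlap l (fst ij) (snd ij)}"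
  let ?c = "2 / real n * (\<Sum>k<n + 1. e k)"
  have c_nonneg: "0 \<le> ?c" by (intro mult_nonneg_nonneg sum_nonneg e) auto
  have "S = (\<Union>ij. {ij} \<times> ?A ij)" by (auto simp: S_def)
  also have "\<dots> \<in> sets (?M \<Otimes>\<^sub>M P)"
    by (intro sets.countable_UN' pair_measureI) (auto intro: read2_event)
  finally have S: "S \<in> sets (?M \<Otimes>\<^sub>M P)" .
  have n: "0 < n" using l by simp
  have inner: "(\<integral>\<^sup>+ j. ennreal (e (nat \<bar>j - i\<bar>)) \<partial>pmf_of_set (second_set n l i)) \<le> ennreal ?c"
    if i: "i \<in> {1..int n}" for i
  proof -
    note ss = second_set_props[OF l i]
    have ne: "second_set n l i \<noteq> {}" using ss n by auto
    have "(\<integral>\<^sup>+ j. ennreal (e (nat \<bar>j - i\<bar>)) \<partial>pmf_of_set (second_set n l i))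
        = (\<Sum>j\<in>second_set n l i. ennreal (e (nat \<bar>j - i\<bar>))) / ennreal (real n)"
      using ss ne by (simp add: nn_integral_pmf_of_set ennreal_of_nat_eq_real_of_nat)
    also have "\<dots> = ennreal ((\<Sum>j\<in>second_set n l i. e (nat \<bar>j - i\<bar>)) / real n)"
      using e n by (simp add: sum_ennreal divide_ennreal sum_nonneg)
    also have "\<dots> \<le> ennreal ?c"
    proof (rule ennreal_leI)
      have "(\<Sum>j\<in>second_set n l i. e (nat \<bar>j - i\<bar>)) \<le> 2 * (\<Sum>k<n + 1. e k)"
        by (rule sum_abs_diff_le) (use ss e in auto)
      then show "(\<Sum>j\<in>second_set n l i. e (nat \<bar>j - i\<bar>)) / real n \<le> ?c"
        using divide_right_mono[of _ _ "real n"] by fastforce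
    qed
    finally show ?thesis .
  qed
  have "emeasure (?M \<Otimes>\<^sub>M P) S = (\<integral>\<^sup>+ ij. emeasure P (Pair ij -` S) \<partial>?M)"
    by (rule emeasure_pair_measure_alt[OF S])
  also have "\<dots> \<le> (\<integral>\<^sup>+ ij. ennreal (e (nat \<bar>snd ij - fst ij\<bar>)) \<partial>?M)"
  proof (rule nn_integral_mono)
    fix ij
    have "Pair ij -` S = ?A ij" by (auto simp: S_def)
    then show "emeasure P (Pair ij -` S) \<le> ennreal (e (nat \<bar>snd ij - fst ij\<bar>))"
      using pair[of "fst ij" "snd ij"] by (auto simp: emeasure_eq_measure pair_error_def intro: ennreal_leI)
  qed
  also have "\<dots> = (\<integral>\<^sup>+ i. (\<integral>\<^sup>+ j. ennreal (e (nat \<bar>j - i\<bar>)) \<partial>pmf_of_set (second_set n l i))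
      \<partial>pmf_of_set {1..int n})"
    by (simp add: index_pmf_def nn_integral_bind_pmf nn_integral_return_pmf)
  also have "\<dots> \<le> (\<integral>\<^sup>+ i. ennreal ?c \<partial>pmf_of_set {1..int n})"
    by (rule nn_integral_mono_AE) (use n inner in \<open>auto simp: AE_measure_pmf_iff\<close>)
  also have "\<dots> = ennreal ?c"
    by (simp add: measure_pmf.emeasure_space_1[simplified])
  finally show ?thesis
    unfolding error_prob_def S_def[symmetric] measure_def
    using c_nonneg by (metis enn2real_leI)
qed

lemma opt_error_le:
  assumes "\<And>u v. Th u v \<in> overlap_range l"
  shows "opt_error P n l \<le> error_prob P n l Th"
  unfolding opt_error_def
  by (rule cINF_lower) (use assms in \<open>auto intro!: bdd_belowI[where m = 0] simp: error_prob_def\<close>)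

text \<open>The constant detector 0 errs exactly when the distance of the reads is less than
  \<open>l\<close>.\<close>

lemma opt_error_trivial:
  assumes "1 \<le> l" "2 * l \<le> n"
  shows "opt_error P n l \<le> 2 * real l / real n"
proof -
  have "opt_error P n l \<le> error_prob P n l (\<lambda>_ _. 0)"
    by (rule opt_error_le) (simp add: overlap_range_def)
  also have "\<dots> \<le> 2 / real n * (\<Sum>k<n + 1. of_bool (k < l))"
    by (rule error_prob_le[OF assms])
      (auto simp: pair_error_def overlap_eq_0_iff eq_commute[of 0] nat_less_iff)
  also have "(\<Sum>k<n + 1. of_bool (k < l)) = real l"
  proof -
    have "{..<n + 1} \<inter> {k. k < l} = {..<l}" using assms by auto
    then show ?thesis by (simp add: sum_of_bool_eq del: sum.lessThan_Suc)
  qed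
  finally show ?thesis by simp
qed

text \<open>Needed at \<open>n = 1\<close>, where \<open>log n = 0\<close> makes both the read
  length and the claimed bound vanish.\<close>

lemma opt_error_length_0: "opt_error P n 0 \<le> 0"
proof -
  have "opt_error P n 0 \<le> error_prob P n 0 (\<lambda>_ _. 0)"
    by (rule opt_error_le) (simp add: overlap_range_def)
  also have "\<dots> = 0"
    using overlap_eq_0_iff[of 0] by (simp add: error_prob_def)
  finally show ?thesis .
qed

text \<open>A candidate overlap is accepted only if the matching word is improbable: the probability of a
  spurious match of words of probability at most \<open>\<theta>\<close> is governed by \<open>\<theta>\<close>, hence by the Shannon entropy
  rate, whereas the unrestricted collision probability is governed by the smaller collision entropy.\<close>

definition candidate :: "nat \<Rightarrow> nat \<Rightarrow> real \<Rightarrow> 'a list \<Rightarrow> 'a list \<Rightarrow> int \<Rightarrow> bool" where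
  "candidate l \<tau> \<theta> u v t \<longleftrightarrow>
     (\<exists>a\<in>{\<tau>..l}. t = int a \<and> drop (l - a) u = take a v \<and> word_prob (take a v) \<le> \<theta>) \<or>
     (\<exists>a\<in>{\<tau>..<l}. t = - int a \<and> drop (l - a) v = take a u \<and> word_prob (take a u) \<le> \<theta>)"

text \<open>Any choice among several candidates will do: the analysis bounds the probability that a
  false candidate exists at all.\<close>

definition detector :: "nat \<Rightarrow> nat \<Rightarrow> real \<Rightarrow> 'a list \<Rightarrow> 'a list \<Rightarrow> int" where
  "detector l \<tau> \<theta> u v = (if \<exists>t. candidate l \<tau> \<theta> u v t then SOME t. candidate l \<tau> \<theta> u v t else 0)"

lemma detector_cases: "candidate l \<tau> \<theta> u v (detector l \<tau> \<theta> u v) \<or>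
    detector l \<tau> \<theta> u v = 0 \<and> (\<forall>t. \<not> candidate l \<tau> \<theta> u v t)"
  unfolding detector_def by (metis someI_ex)

lemma detector_range: "detector l \<tau> \<theta> u v \<in> overlap_range l"
  using detector_cases[of l \<tau> \<theta> u v] by (auto simp: candidate_def overlap_range_def)

lemma candidate_read:
  "candidate l \<tau> \<theta> (read l x i) (read l x j) t \<longleftrightarrow>
     (\<exists>a\<in>{\<tau>..l}. t = int a \<and> read a x (i + int (l - a)) = read a x j \<and> word_prob (read a x j) \<le> \<theta>) \<or>
     (\<exists>a\<in>{\<tau>..<l}. t = - int a \<and> read a x (j + int (l - a)) = read a x i \<and> word_prob (read a x i) \<le> \<theta>)"
  unfolding candidate_def by (intro arg_cong2[where f = "(\<or>)"] bex_cong refl) (auto simp: take_read drop_read)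

lemma prob_repeat_sym_le:
  assumes W: "\<And>w. w \<in> blocks t \<Longrightarrow> Q w \<Longrightarrow> word_prob w \<le> \<theta>" and "0 \<le> \<theta>"
    and gap: "int t + int s \<le> \<bar>v - u\<bar>"
  shows "prob {x. read t x u = read t x v \<and> Q (read t x v)} \<le> \<theta> + mix s"
proof (cases "u \<le> v")
  case True
  have "prob {x. read t x u = read t x v \<and> Q (read t x v)}
      = prob {x. read t x u = read t x v \<and> Q (read t x u)}"
    by (rule arg_cong[where f = prob]) auto
  also have "\<dots> \<le> \<theta> + mix s"
    by (rule prob_repeat_le[OF W \<open>0 \<le> \<theta>\<close>]) (use gap True in auto)
  finally show ?thesis .
next
  case False
  have "prob {x. read t x v = read t x u \<and> Q (read t x v)} \<le> \<theta> + mix s"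
    by (rule prob_repeat_le[OF W \<open>0 \<le> \<theta>\<close>]) (use gap False in auto)
  then show ?thesis by (simp add: eq_commute)
qed

text \<open>Every candidate is false here. A suffix and a prefix of length \<open>a \<le> l\<close>
  start at least \<open>a + s\<close> apart, so \<open>prob_repeat_sym_le\<close> applies to each of
  the \<open>2 * (l + 1)\<close> combinations of sign and length.\<close>

lemma pair_error_disjoint:
  assumes "0 \<le> \<theta>" and s: "int l + int s \<le> \<bar>j - i\<bar>"
  shows "pair_error l (detector l \<tau> \<theta>) i j \<le> 2 * real l * (\<theta> + mix s) + 2 * (\<theta> + mix s)"
proof -
  let ?A = "\<lambda>a. {x. read a x (i + int (l - a)) = read a x j \<and> word_prob (read a x j) \<le> \<theta>}"
  let ?B = "\<lambda>a. {x. read a x (j + int (l - a)) = read a x i \<and> word_prob (read a x i) \<le> \<theta>}"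
  have ev: "?A a \<in> sets P" "?B a \<in> sets P" for a
    by (rule read2_event)+
  have T: "overlap l i j = 0" using s by (simp add: overlap_eq_0_iff)
  have "pair_error l (detector l \<tau> \<theta>) i j \<le> prob ((\<Union>a\<in>{..l}. ?A a) \<union> (\<Union>a\<in>{..l}. ?B a))"
    unfolding pair_error_def
  proof (rule finite_measure_mono)
    show "{x. detector l \<tau> \<theta> (read l x i) (read l x j) \<noteq> overlap l i j}
        \<subseteq> (\<Union>a\<in>{..l}. ?A a) \<union> (\<Union>a\<in>{..l}. ?B a)"
    proof
      fix x assume "x \<in> {x. detector l \<tau> \<theta> (read l x i) (read l x j) \<noteq> overlap l i j}"
      then obtain t where "candidate l \<tau> \<theta> (read l x i) (read l x j) t"
        using T detector_cases[of l \<tau> \<theta> "read l x i" "read l x j"] by auto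
      then show "x \<in> (\<Union>a\<in>{..l}. ?A a) \<union> (\<Union>a\<in>{..l}. ?B a)"
        unfolding candidate_read by fastforce
    qed
  qed (intro sets.Un sets.finite_UN ev; simp)
  also have "\<dots> \<le> prob (\<Union>a\<in>{..l}. ?A a) + prob (\<Union>a\<in>{..l}. ?B a)"
    by (rule measure_Un_le; intro sets.Un sets.finite_UN ev; simp)
  also have "\<dots> \<le> (\<Sum>a\<in>{..l}. prob (?A a)) + (\<Sum>a\<in>{..l}. prob (?B a))"
    by (intro add_mono finite_measure_subadditive_finite image_subsetI ev; simp)
  also have "\<dots> \<le> (\<Sum>a\<in>{..l}. \<theta> + mix s) + (\<Sum>a\<in>{..l}. \<theta> + mix s)"
    by (intro add_mono sum_mono prob_repeat_sym_le) (use assms in auto)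
  finally show ?thesis by (simp add: algebra_simps)
qed

lemma sum_repeat_prob_shift_le:
  assumes "finite A" and A: "\<And>a. a \<in> A \<Longrightarrow> int a \<noteq> c \<and> \<bar>int a - c\<bar> \<le> int N"
  shows "(\<Sum>a\<in>A. repeat_prob (nat \<bar>int a - c\<bar>) t) \<le> 2 * (\<Sum>r=1..N. repeat_prob r t)"
proof -
  \<comment> \<open>Shift 0 always matches and is excluded from the right-hand side; setting the
    value there to 0 fits the sum to \<open>sum_abs_diff_le\<close>.\<close>
  let ?g = "\<lambda>r. if r = 0 then 0 else repeat_prob r t"
  have "(\<Sum>a\<in>A. repeat_prob (nat \<bar>int a - c\<bar>) t) = (\<Sum>a\<in>int ` A. ?g (nat \<bar>a - c\<bar>))"
    using A by (auto simp: sum.reindex intro!: sum.cong)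
  also have "\<dots> \<le> 2 * (\<Sum>r<Suc N. ?g r)"
    by (rule sum_abs_diff_le) (use assms in force)+
  also have "(\<Sum>r<Suc N. ?g r) = (\<Sum>r=1..N. repeat_prob r t)"
    by (rule sum.mono_neutral_cong_right) auto
  finally show ?thesis .
qed

text \<open>Either the shared word is too probable for the true overlap to be a candidate, or some
  false candidate makes a word of length at least \<open>\<tau>\<close> agree with its copy at a
  nonzero shift.\<close>

lemma pair_error_overlapping:
  assumes ij: "\<bar>j - i\<bar> < int l" "int \<tau> \<le> int l - \<bar>j - i\<bar>"
  shows "pair_error l (detector l \<tau> \<theta>) i j
    \<le> prob {x. \<theta> < word_prob (read \<tau> x 0)} + 4 * (\<Sum>r=1..2 * l. repeat_prob r \<tau>)"
proof -
  define T where "T = overlap l i j"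
  define a0 where "a0 = l - nat \<bar>j - i\<bar>"
  \<comment> \<open>The start of the shared stretch, whose length is \<open>a0\<close>.\<close>
  define p where "p = max i j"
  let ?A = "\<lambda>a. {x. read a x (i + int (l - a)) = read a x j}"
  let ?B = "\<lambda>a. {x. read a x (j + int (l - a)) = read a x i}"
  let ?IA = "{a\<in>{\<tau>..l}. int a \<noteq> T}" and ?IB = "{a\<in>{\<tau>..<l}. - int a \<noteq> T}"
  let ?C = "{x. \<theta> < word_prob (read \<tau> x p)}"
  have a0: "\<tau> \<le> a0" "a0 \<le> l" "i \<le> j \<Longrightarrow> T = int a0 \<and> i + int (l - a0) = j"
    "j < i \<Longrightarrow> T = - int a0 \<and> j + int (l - a0) = i \<and> a0 < l"
    using ij by (auto simp: a0_def T_def overlap_def)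
  have ev: "?A a \<in> sets P" "?B a \<in> sets P" "?C \<in> sets P" for a
    by (rule read2_event read_event)+
  have sub: "{x. detector l \<tau> \<theta> (read l x i) (read l x j) \<noteq> overlap l i j}
      \<subseteq> ?C \<union> ((\<Union>a\<in>?IA. ?A a) \<union> (\<Union>a\<in>?IB. ?B a))"
  proof
    fix x assume x: "x \<in> {x. detector l \<tau> \<theta> (read l x i) (read l x j) \<noteq> overlap l i j}"
    let ?c = "candidate l \<tau> \<theta> (read l x i) (read l x j)"
    show "x \<in> ?C \<union> ((\<Union>a\<in>?IA. ?A a) \<union> (\<Union>a\<in>?IB. ?B a))"
    proof (cases "x \<in> ?C")
      case False
      \<comment> \<open>Extending a word only lowers its probability, so controlling the prefix of
        length \<open>\<tau>\<close> covers every overlap length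
        \<open>a0 \<ge> \<tau>\<close>.\<close>
      have "word_prob (read a0 x p) \<le> \<theta>"
        using word_prob_take_le[of "read a0 x p" \<tau>] False a0 by (simp add: take_read)
      then have "?c T"
        unfolding candidate_read using a0 by (cases "i \<le> j") (auto simp: p_def)
      then obtain t where "?c t" "t \<noteq> T"
        using detector_cases[of l \<tau> \<theta> "read l x i" "read l x j"] x by (auto simp: T_def)
      then show ?thesis unfolding candidate_read by fastforce
    qed simp
  qed
  have "pair_error l (detector l \<tau> \<theta>) i j \<le> prob (?C \<union> ((\<Union>a\<in>?IA. ?A a) \<union> (\<Union>a\<in>?IB. ?B a)))"
    unfolding pair_error_def by (rule finite_measure_mono[OF sub]; intro sets.Un sets.finite_UN ev; simp)
  also have "\<dots> \<le> prob ?C + prob ((\<Union>a\<in>?IA. ?A a) \<union> (\<Union>a\<in>?IB. ?B a))"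
    by (rule measure_Un_le; intro sets.Un sets.finite_UN ev; simp)
  also have "prob ((\<Union>a\<in>?IA. ?A a) \<union> (\<Union>a\<in>?IB. ?B a)) \<le> prob (\<Union>a\<in>?IA. ?A a) + prob (\<Union>a\<in>?IB. ?B a)"
    by (rule measure_Un_le; intro sets.Un sets.finite_UN ev; simp)
  also have "\<dots> \<le> (\<Sum>a\<in>?IA. prob (?A a)) + (\<Sum>a\<in>?IB. prob (?B a))"
    by (intro add_mono finite_measure_subadditive_finite image_subsetI ev; simp)
  \<comment> \<open>The two windows differ by the shift \<open>a - (l + i - j)\<close>, which is
    nonzero because \<open>a\<close> is not the true overlap. Truncating them to length
    \<open>\<tau>\<close> makes the bound uniform in \<open>a\<close>.\<close>
  also have "(\<Sum>a\<in>?IA. prob (?A a)) \<le> (\<Sum>a\<in>?IA. repeat_prob (nat \<bar>int a - (int l + i - j)\<bar>) \<tau>)"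
  proof (rule sum_mono)
    fix a assume a: "a \<in> ?IA"
    then have "prob (?A a) = repeat_prob (nat \<bar>int a - (int l + i - j)\<bar>) a"
      by (simp add: prob_match_eq of_nat_diff algebra_simps)
    also have "\<dots> \<le> repeat_prob (nat \<bar>int a - (int l + i - j)\<bar>) \<tau>"
      using a by (intro repeat_prob_mono) auto
    finally show "prob (?A a) \<le> repeat_prob (nat \<bar>int a - (int l + i - j)\<bar>) \<tau>" .
  qed
  also have "\<dots> \<le> 2 * (\<Sum>r=1..2 * l. repeat_prob r \<tau>)"
    by (rule sum_repeat_prob_shift_le) (use ij in \<open>auto simp: T_def overlap_def\<close>)
  also have "(\<Sum>a\<in>?IB. prob (?B a)) \<le> (\<Sum>a\<in>?IB. repeat_prob (nat \<bar>int a - (int l + j - i)\<bar>) \<tau>)"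
  proof (rule sum_mono)
    fix a assume a: "a \<in> ?IB"
    then have "prob (?B a) = repeat_prob (nat \<bar>int a - (int l + j - i)\<bar>) a"
      by (simp add: prob_match_eq of_nat_diff algebra_simps)
    also have "\<dots> \<le> repeat_prob (nat \<bar>int a - (int l + j - i)\<bar>) \<tau>"
      using a by (intro repeat_prob_mono) auto
    finally show "prob (?B a) \<le> repeat_prob (nat \<bar>int a - (int l + j - i)\<bar>) \<tau>" .
  qed
  also have "\<dots> \<le> 2 * (\<Sum>r=1..2 * l. repeat_prob r \<tau>)"
    by (rule sum_repeat_prob_shift_le) (use ij in \<open>auto simp: T_def overlap_def\<close>)
  also have "prob ?C = prob {x. \<theta> < word_prob (read \<tau> x 0)}"
    using prob_read_shift[of "\<lambda>u v. \<theta> < word_prob u" \<tau> 0 p 0 0] by simp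
  finally show ?thesis by simp
qed

lemma opt_error_detector:
  assumes l: "1 \<le> l" "2 * l \<le> n" and "0 \<le> \<theta>"
    and \<epsilon>: "prob {x. \<theta> < word_prob (read \<tau> x 0)} + 4 * (\<Sum>r=1..2 * l. repeat_prob r \<tau>) \<le> \<epsilon>"
    and \<kappa>: "\<And>N. (\<Sum>s\<in>{S..<N}. mix s) \<le> \<kappa>"
  shows "opt_error P n l \<le> 2 / real n *
    (real \<tau> + real l * \<epsilon> + real S + 4 * real l * (real (n + 1) * \<theta>) + 4 * real l * \<kappa>)"
proof -
  have \<epsilon>_nonneg: "0 \<le> \<epsilon>"
    using \<epsilon> by (rule order_trans[rotated]) (intro add_nonneg_nonneg mult_nonneg_nonneg sum_nonneg; simp)
  \<comment> \<open>Four ranges of the distance \<open>k\<close>: overlaps shorter than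
    \<open>\<tau>\<close>, given up; longer overlaps, at cost \<open>\<epsilon>\<close>; gaps below
    \<open>S\<close>, given up since mixing may be weak there; larger gaps, where
    \<open>2 * (l + 1) \<le> 4 * l\<close> possible matches are controlled by
    \<open>\<theta>\<close> and the tail of \<open>mix\<close>.\<close>
  define e where "e k = of_bool (l < k + \<tau> \<and> k < l) + \<epsilon> * of_bool (k < l) + of_bool (l \<le> k \<and> k < l + S)
    + (4 * real l * \<theta> + 4 * real l * (if l + S \<le> k then mix (k - l) else 0))" for k
  have e_nonneg: "0 \<le> e k" for k
    unfolding e_def using \<epsilon>_nonneg \<open>0 \<le> \<theta>\<close> mix_nonneg by (intro add_nonneg_nonneg mult_nonneg_nonneg) auto
  have pair: "pair_error l (detector l \<tau> \<theta>) i j \<le> e (nat \<bar>j - i\<bar>)" for i j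
  proof -
    let ?k = "nat \<bar>j - i\<bar>"
    have le1: "pair_error l (detector l \<tau> \<theta>) i j \<le> 1" by (simp add: pair_error_def)
    have rest: "0 \<le> 4 * real l * \<theta>" "0 \<le> 4 * real l * (if l + S \<le> ?k then mix (?k - l) else 0)"
      using \<open>0 \<le> \<theta>\<close> mix_nonneg by auto
    consider "l < ?k + \<tau>" "?k < l" | "?k + \<tau> \<le> l" "?k < l" | "l \<le> ?k" "?k < l + S" | "l + S \<le> ?k"
      by linarith
    then show ?thesis
    proof cases
      case 1
      then show ?thesis using le1 \<epsilon>_nonneg rest unfolding e_def by (simp add: algebra_simps)
    next
      case 2
      then have "pair_error l (detector l \<tau> \<theta>) i j \<le> \<epsilon>"
        by (intro order_trans[OF pair_error_overlapping \<epsilon>]) auto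
      then show ?thesis using 2 rest unfolding e_def by (simp add: algebra_simps)
    next
      case 3
      then show ?thesis using le1 rest unfolding e_def by (simp add: algebra_simps)
    next
      case 4
      then have "pair_error l (detector l \<tau> \<theta>) i j
          \<le> 2 * real l * (\<theta> + mix (?k - l)) + 2 * (\<theta> + mix (?k - l))"
        by (intro pair_error_disjoint \<open>0 \<le> \<theta>\<close>) auto
      also have "\<dots> \<le> 4 * real l * (\<theta> + mix (?k - l))"
        using mult_right_mono[of 1 "real l" "\<theta> + mix (?k - l)"] l \<open>0 \<le> \<theta>\<close> mix_nonneg[of "?k - l"] by simp
      finally show ?thesis using 4 unfolding e_def by (simp add: algebra_simps)
    qed
  qed
  have "opt_error P n l \<le> error_prob P n l (detector l \<tau> \<theta>)"
    by (rule opt_error_le) (rule detector_range)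
  also have "\<dots> \<le> 2 / real n * (\<Sum>k<n + 1. e k)"
    by (rule error_prob_le[OF l e_nonneg pair])
  also have "\<dots> \<le> 2 / real n *
    (real \<tau> + real l * \<epsilon> + real S + 4 * real l * (real (n + 1) * \<theta>) + 4 * real l * \<kappa>)"
  proof (rule mult_left_mono)
    have count: "(\<Sum>k<n + 1. of_bool (Q k)) \<le> real m"
      if "{k. Q k} \<subseteq> {a..<a + m}" for Q :: "nat \<Rightarrow> bool" and a m
    proof -
      have "(\<Sum>k<n + 1. of_bool (Q k)) = real (card ({..<n + 1} \<inter> {k. Q k}))"
        by (simp add: sum_of_bool_eq del: sum.lessThan_Suc)
      also have "card ({..<n + 1} \<inter> {k. Q k}) \<le> card {a..<a + m}"
        by (rule card_mono) (use that in auto)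
      finally show ?thesis by simp
    qed
    have 1: "(\<Sum>k<n + 1. of_bool (l < k + \<tau> \<and> k < l)) \<le> real \<tau>"
    proof (rule count)
      show "{k. l < k + \<tau> \<and> k < l} \<subseteq> {l - \<tau>..<l - \<tau> + \<tau>}" by auto
    qed
    have 2: "(\<Sum>k<n + 1. of_bool (k < l)) \<le> real l"
    proof (rule count)
      show "{k. k < l} \<subseteq> {0..<0 + l}" by auto
    qed
    have 3: "(\<Sum>k<n + 1. of_bool (l \<le> k \<and> k < l + S)) \<le> real S"
    proof (rule count)
      show "{k. l \<le> k \<and> k < l + S} \<subseteq> {l..<l + S}" by auto
    qed
    have 4: "(\<Sum>k<n + 1. if l + S \<le> k then mix (k - l) else 0) \<le> \<kappa>"
    proof -
      have "(\<Sum>k<n + 1. if l + S \<le> k then mix (k - l) else 0) = (\<Sum>k\<in>{l + S..<n + 1}. mix (k - l))"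
        by (rule sum.mono_neutral_cong_right) auto
      also have "\<dots> = (\<Sum>s\<in>{S..<n + 1 - l}. mix s)"
        by (rule sum.reindex_bij_witness[where i = "\<lambda>s. s + l" and j = "\<lambda>k. k - l"]) auto
      finally show ?thesis using \<kappa> by simp
    qed
    have "(\<Sum>k<n + 1. e k) = (\<Sum>k<n + 1. of_bool (l < k + \<tau> \<and> k < l)) + \<epsilon> * (\<Sum>k<n + 1. of_bool (k < l))
        + (\<Sum>k<n + 1. of_bool (l \<le> k \<and> k < l + S))
        + (real (n + 1) * (4 * real l * \<theta>) + 4 * real l * (\<Sum>k<n + 1. if l + S \<le> k then mix (k - l) else 0))"
      unfolding e_def sum.distrib sum_distrib_left[symmetric] by simp
    also have "\<dots> \<le> real \<tau> + \<epsilon> * real l + real S + (real (n + 1) * (4 * real l * \<theta>) + 4 * real l * \<kappa>)"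
      using 1 2 3 4 \<epsilon>_nonneg by (intro add_mono mult_left_mono order_refl) auto
    finally show "(\<Sum>k<n + 1. e k)
        \<le> real \<tau> + real l * \<epsilon> + real S + 4 * real l * (real (n + 1) * \<theta>) + 4 * real l * \<kappa>"
      by (simp add: mult_ac)
  qed simp
  finally show ?thesis .
qed

end

subsection \<open>Asymptotics of the optimal error\<close>

lemma sum_tail_small:
  fixes f :: "nat \<Rightarrow> real"
  assumes f: "summable f" and nonneg: "\<And>n. 0 \<le> f n" and "0 < \<kappa>"
  obtains S where "\<And>N. (\<Sum>s\<in>{S..<N}. f s) \<le> \<kappa>"
proof -
  obtain S where S: "\<And>m n. m \<ge> S \<Longrightarrow> norm (sum f {m..<n}) < \<kappa>"
    using f \<open>0 < \<kappa>\<close> unfolding summable_Cauchy by blast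
  show ?thesis
  proof (rule that)
    show "(\<Sum>s\<in>{S..<N}. f s) \<le> \<kappa>" for N
      using S[of S N] by simp
  qed
qed

lemma read_len_le:
  assumes "0 \<le> \<beta> * log q (real n)"
  shows "real (read_len q \<beta> n) \<le> \<beta> * log q (real n) + 1"
proof -
  have "0 \<le> round (\<beta> * log q (real n))" using assms by (simp add: round_def)
  then show ?thesis
    using of_int_round_le[of "\<beta> * log q (real n)"] by (simp add: read_len_def)
qed

lemma read_len_ge: "\<beta> * log q (real n) - 1 \<le> real (read_len q \<beta> n)"
  using of_int_round_ge[of "\<beta> * log q (real n)"] by (simp add: read_len_def)

lemma log_at_top:
  assumes "1 < q"
  shows "filterlim (\<lambda>n. log q (real n)) at_top sequentially"
proof -
  have "0 < ln q" using assms by simp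
  then show ?thesis unfolding log_def by real_asymp
qed

lemma eventually_read_len:
  assumes "1 < q" "0 < \<beta>"
  shows "eventually (\<lambda>n. 1 \<le> read_len q \<beta> n \<and> 2 * read_len q \<beta> n \<le> n
    \<and> real (read_len q \<beta> n) \<le> \<beta> * log q (real n) + 1 \<and> 1 \<le> \<beta> * log q (real n)) sequentially"
proof -
  have pos: "0 < \<beta> / ln q" using assms by simp
  have "filterlim (\<lambda>n. \<beta> / ln q * ln (real n)) at_top sequentially"
    using pos by real_asymp
  then have "eventually (\<lambda>n. 2 \<le> \<beta> / ln q * ln (real n)) sequentially"
    by (simp add: filterlim_at_top)
  moreover have "eventually (\<lambda>n. 2 * (\<beta> / ln q * ln (real n) + 1) \<le> real n) sequentially"
    using pos by real_asymp
  ultimately show ?thesis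
  proof eventually_elim
    case (elim n)
    then have \<Lambda>: "2 \<le> \<beta> * log q (real n)" "2 * (\<beta> * log q (real n) + 1) \<le> real n"
      by (simp_all add: log_def)
    then have le: "real (read_len q \<beta> n) \<le> \<beta> * log q (real n) + 1"
      by (intro read_len_le) simp
    with \<Lambda> have "2 * real (read_len q \<beta> n) \<le> real n" by simp
    then have "2 * read_len q \<beta> n \<le> n" by linarith
    moreover have "1 \<le> read_len q \<beta> n" using read_len_ge[of \<beta> q n] \<Lambda> by linarith
    ultimately show ?case using le \<Lambda> by simp
  qed
qed

section \<open>The two asymptotic bounds, from the trivial and the matching detector\<close>

context mixing_process
begin

lemma opt_error_trivial_asymp:
  assumes q: "1 < q" and "0 < \<beta>" and "0 < \<eta>"
  shows "eventually (\<lambda>n. opt_error P n (read_len q \<beta> n)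
    \<le> 2 * (\<beta> + \<eta>) * log q (real n) / real n) sequentially"
proof -
  have "eventually (\<lambda>n. 1 / \<eta> \<le> log q (real n)) sequentially"
    using log_at_top[OF q] by (simp add: filterlim_at_top)
  with eventually_read_len[OF q \<open>0 < \<beta>\<close>] show ?thesis
  proof eventually_elim
    case (elim n)
    have "1 \<le> \<eta> * log q (real n)" using elim \<open>0 < \<eta>\<close> by (simp add: field_simps)
    with elim have "2 * real (read_len q \<beta> n) \<le> 2 * (\<beta> + \<eta>) * log q (real n)"
      by (simp add: algebra_simps)
    then show ?case
      using opt_error_trivial[of "read_len q \<beta> n" n] elim
        divide_right_mono[of "2 * real (read_len q \<beta> n)" _ "real n"]
      by fastforce
  qed
qed

lemma opt_error_entropy_asymp:
  assumes q: "1 < q" and \<beta>: "0 < \<beta>" and \<eta>: "0 < \<eta>" and H: "0 < H"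
    and lim: "(\<lambda>t. block_entropy q (2 * t + 1) / real (2 * t + 1)) \<longlonglongrightarrow> H"
  shows "eventually (\<lambda>n. opt_error P n (read_len q \<beta> n)
    \<le> 2 * (1 / H + \<eta>) * log q (real n) / real n) sequentially"
proof -
  \<comment> \<open>The allowance \<open>\<eta> * \<Lambda>\<close> is cut into six parts: the
    excess \<open>\<gamma>\<close> in \<open>\<tau>\<close>, the \<open>\<epsilon>\<close> term,
    \<open>S\<close> with the rounding of \<open>\<tau>\<close>, the \<open>\<theta>\<close> term
    and the mixing tail use at most one each. \<open>\<delta>\<close> is chosen so that
    \<open>(1 + \<gamma>) * (H - \<delta>) = H * (1 + \<gamma> / 2)\<close>.\<close>
  define \<gamma> where "\<gamma> = \<eta> * H / 6"
  define \<delta> where "\<delta> = H * \<gamma> / (2 * (1 + \<gamma>))"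
  define \<epsilon> where "\<epsilon> = \<eta> / (12 * \<beta>)"
  define \<kappa> where "\<kappa> = \<eta> / (48 * \<beta>)"
  have \<gamma>: "0 < \<gamma>" using \<eta> H by (simp add: \<gamma>_def)
  then have pos: "0 < \<gamma>" "0 < \<delta>" "0 < \<epsilon>" "0 < \<kappa>"
    using \<eta> H \<beta> by (simp_all add: \<delta>_def \<epsilon>_def \<kappa>_def)
  define \<Lambda> where "\<Lambda> n = log q (real n)" for n :: nat
  define l where "l = read_len q \<beta>"
  define \<tau> where "\<tau> n = nat \<lceil>(1 + \<gamma>) * \<Lambda> n / H\<rceil>" for n
  \<comment> \<open>The exponent exceeds 1, so \<open>n * \<theta>\<close> vanishes and spurious
    matches over about \<open>n\<close> distances are harmless. It stays below
    \<open>1 + \<gamma>\<close>, so typical words of length \<open>\<tau>\<close> still have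
    probability at most \<open>\<theta>\<close>.\<close>
  define \<theta> where "\<theta> n = real n powr - (1 + \<gamma> / 2)" for n :: nat
  have \<Lambda>_top: "filterlim \<Lambda> at_top sequentially"
    unfolding \<Lambda>_def by (rule log_at_top[OF q])
  have \<tau>_ge: "(1 + \<gamma>) * \<Lambda> n / H \<le> real (\<tau> n)" for n
    unfolding \<tau>_def by (rule real_nat_ceiling_ge)
  have "filterlim (\<lambda>n. (1 + \<gamma>) / H * \<Lambda> n) at_top sequentially"
    using pos H by (intro filterlim_tendsto_pos_mult_at_top[OF tendsto_const _ \<Lambda>_top]) simp
  then have "filterlim (\<lambda>n. real (\<tau> n)) at_top sequentially"
    by (rule filterlim_at_top_mono) (use \<tau>_ge in \<open>auto intro!: always_eventually\<close>)
  then have \<tau>_top: "filterlim \<tau> at_top sequentially"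
    by (simp add: filterlim_sequentially_iff_filterlim_real)
  obtain S where S: "\<And>N. (\<Sum>s\<in>{S..<N}. mix s) \<le> \<kappa>"
    using sum_tail_small[OF mix_summable mix_nonneg pos(4)] by blast
  \<comment> \<open>The factor \<open>4 * \<beta> * H\<close> comes from
    \<open>2 * l \<le> 4 * \<beta> * \<Lambda>\<close> and
    \<open>\<Lambda> \<le> H * \<tau>\<close>. The sum is later multiplied by 4, which uses half of
    \<open>\<epsilon>\<close>.\<close>
  obtain t0 where t0: "\<And>t N. t0 \<le> t \<Longrightarrow> real N \<le> 4 * \<beta> * H * real t \<Longrightarrow> (\<Sum>r=1..N. repeat_prob r t) \<le> \<epsilon> / 8"
    using sum_repeat_prob_small[of "\<epsilon> / 8" "4 * \<beta> * H"] pos \<beta> H by auto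
  have "(\<lambda>t. prob {x. q powr (- (real t * (H - \<delta>))) < word_prob (read t x 0)}) \<longlonglongrightarrow> 0"
    by (rule aep_lower[OF q pos(2) _ lim]) (use H in simp)
  from filterlim_compose[OF this \<tau>_top]
  have ev_aep: "eventually (\<lambda>n. prob {x. q powr (- (real (\<tau> n) * (H - \<delta>))) < word_prob (read (\<tau> n) x 0)} < \<epsilon> / 2) sequentially"
    using pos by (intro order_tendstoD(2)) auto
  have ev_t0: "eventually (\<lambda>n. t0 \<le> \<tau> n) sequentially"
    using \<tau>_top by (simp add: filterlim_at_top)
  have "(\<lambda>n. real (n + 1) * \<theta> n) \<longlonglongrightarrow> 0"
    unfolding \<theta>_def using pos by real_asymp
  then have ev_\<theta>: "eventually (\<lambda>n. real (n + 1) * \<theta> n < \<kappa>) sequentially"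
    using pos by (intro order_tendstoD(2)) auto
  have ev_\<Lambda>: "eventually (\<lambda>n. 6 * (real S + 1) / \<eta> \<le> \<Lambda> n) sequentially"
    using \<Lambda>_top by (simp add: filterlim_at_top)
  have ev_n: "eventually (\<lambda>n. 0 < n) sequentially" by (rule eventually_gt_at_top)
  from eventually_read_len[OF q \<beta>] ev_aep ev_t0 ev_\<theta> ev_\<Lambda> ev_n show ?thesis
    unfolding \<Lambda>_def[symmetric] l_def[symmetric]
  proof eventually_elim
    case (elim n)
    have l: "real (l n) \<le> 2 * \<beta> * \<Lambda> n" using elim by simp
    have S\<Lambda>: "real S + 1 \<le> \<eta> / 6 * \<Lambda> n" using elim \<eta> by (simp add: field_simps)
    have \<Lambda>: "0 < \<Lambda> n" using S\<Lambda> \<eta> by (smt (verit) of_nat_0_le_iff zero_less_mult_pos divide_pos_pos)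
    have \<delta>: "(1 + \<gamma>) * (H - \<delta>) = H * (1 + \<gamma> / 2)" "0 \<le> H - \<delta>"
      using pos(1) H by (auto simp: \<delta>_def field_simps)
    have "\<Lambda> n * (1 + \<gamma> / 2) \<le> real (\<tau> n) * (H - \<delta>)"
    proof -
      have "\<Lambda> n * (1 + \<gamma> / 2) = (1 + \<gamma>) * (H - \<delta>) * \<Lambda> n / H"
        unfolding \<delta>(1) using H by simp
      also have "\<dots> = (1 + \<gamma>) * \<Lambda> n / H * (H - \<delta>)" by simp
      also have "\<dots> \<le> real (\<tau> n) * (H - \<delta>)"
        by (intro mult_right_mono \<tau>_ge \<delta>)
      finally show ?thesis .
    qed
    moreover have "\<theta> n = q powr (- (\<Lambda> n * (1 + \<gamma> / 2)))"
    proof -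
      have "real n = q powr \<Lambda> n" using elim q by (simp add: \<Lambda>_def)
      then show ?thesis unfolding \<theta>_def by (simp add: powr_powr algebra_simps)
    qed
    ultimately have "q powr (- (real (\<tau> n) * (H - \<delta>))) \<le> \<theta> n"
      using q by simp
    then have "prob {x. \<theta> n < word_prob (read (\<tau> n) x 0)}
        \<le> prob {x. q powr (- (real (\<tau> n) * (H - \<delta>))) < word_prob (read (\<tau> n) x 0)}"
      by (intro finite_measure_mono read_event) auto
    then have atypical: "prob {x. \<theta> n < word_prob (read (\<tau> n) x 0)} \<le> \<epsilon> / 2"
      using elim by simp
    have "\<Lambda> n / H \<le> (1 + \<gamma>) * \<Lambda> n / H"
      using pos H \<Lambda> by (intro divide_right_mono) auto
    then have "\<Lambda> n \<le> H * real (\<tau> n)" using \<tau>_ge[of n] H by (simp add: field_simps)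
    then have "4 * \<beta> * \<Lambda> n \<le> 4 * \<beta> * (H * real (\<tau> n))" using \<beta> by simp
    also have "\<dots> = 4 * \<beta> * H * real (\<tau> n)" by simp
    finally have "real (2 * l n) \<le> 4 * \<beta> * H * real (\<tau> n)" using l by linarith
    then have "(\<Sum>r=1..2 * l n. repeat_prob r (\<tau> n)) \<le> \<epsilon> / 8"
      using t0 elim by blast
    with atypical have small:
      "prob {x. \<theta> n < word_prob (read (\<tau> n) x 0)} + 4 * (\<Sum>r=1..2 * l n. repeat_prob r (\<tau> n)) \<le> \<epsilon>"
      by simp
    have "opt_error P n (l n) \<le> 2 / real n *
        (real (\<tau> n) + real (l n) * \<epsilon> + real S + 4 * real (l n) * (real (n + 1) * \<theta> n) + 4 * real (l n) * \<kappa>)"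
      by (rule opt_error_detector[OF _ _ _ small S]) (use elim in \<open>auto simp: \<theta>_def\<close>)
    also have "\<dots> \<le> 2 / real n * ((1 / H + \<eta>) * \<Lambda> n)"
    proof (rule mult_left_mono)
      have "real (\<tau> n) \<le> (1 + \<gamma>) * \<Lambda> n / H + 1"
      proof -
        have "0 \<le> (1 + \<gamma>) * \<Lambda> n / H" using pos H \<Lambda> by simp
        then show ?thesis
          unfolding \<tau>_def using of_int_ceiling_le_add_one[of "(1 + \<gamma>) * \<Lambda> n / H"] by simp
      qed
      also have "(1 + \<gamma>) * \<Lambda> n / H = \<Lambda> n / H + \<eta> / 6 * \<Lambda> n"
        using H by (simp add: \<gamma>_def field_simps)
      finally have 1: "real (\<tau> n) \<le> \<Lambda> n / H + \<eta> / 6 * \<Lambda> n + 1" .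
      have "real (l n) * \<epsilon> \<le> 2 * \<beta> * \<Lambda> n * \<epsilon>"
        using l pos by (intro mult_right_mono) auto
      also have "\<dots> = \<eta> / 6 * \<Lambda> n" using \<beta> by (simp add: \<epsilon>_def)
      finally have 2: "real (l n) * \<epsilon> \<le> \<eta> / 6 * \<Lambda> n" .
      have "4 * real (l n) * \<kappa> \<le> 4 * (2 * \<beta> * \<Lambda> n) * \<kappa>"
        using l pos by (intro mult_right_mono mult_left_mono) auto
      also have "\<dots> = \<eta> / 6 * \<Lambda> n" using \<beta> by (simp add: \<kappa>_def)
      finally have 3: "4 * real (l n) * \<kappa> \<le> \<eta> / 6 * \<Lambda> n" .
      have 4: "4 * real (l n) * (real (n + 1) * \<theta> n) \<le> 4 * real (l n) * \<kappa>"
        using elim by (intro mult_left_mono) auto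
      have "(1 / H + \<eta>) * \<Lambda> n = \<Lambda> n / H + 6 * (\<eta> / 6 * \<Lambda> n)"
        by (simp add: algebra_simps)
      moreover have "0 \<le> \<eta> / 6 * \<Lambda> n" using \<eta> \<Lambda> by simp
      ultimately show "real (\<tau> n) + real (l n) * \<epsilon> + real S + 4 * real (l n) * (real (n + 1) * \<theta> n) + 4 * real (l n) * \<kappa>
          \<le> (1 / H + \<eta>) * \<Lambda> n"
        using 1 2 3 4 S\<Lambda> by linarith
    qed simp
    finally show ?case by (simp add: mult_ac)
  qed
qed

end

text \<open>Taking \<open>\<epsilon> n\<close> as the positive part of the relative excess of
  \<open>f n\<close> over the target gives the inequality for every \<open>n > 1\<close>; the
  eventual bounds with arbitrary slack give convergence to 0.\<close>

lemma asymptotic_bound_imp_sequence: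
  fixes f :: "nat \<Rightarrow> real"
  assumes q: "1 < q" and c: "0 < c" and one: "f 1 \<le> 0"
    and ev: "\<And>\<eta>. 0 < \<eta> \<Longrightarrow> eventually (\<lambda>n. f n \<le> 2 * (c + \<eta>) * log q (real n) / real n) sequentially"
  shows "\<exists>\<epsilon>. \<epsilon> \<longlonglongrightarrow> 0 \<and> (\<forall>n\<ge>1. f n \<le> 2 * (1 + \<epsilon> n) * c * log q (real n) / real n)"
proof (intro exI conjI allI impI)
  define \<epsilon> where "\<epsilon> n = max 0 (f n * real n / (2 * c * log q (real n)) - 1)" for n
  show "\<epsilon> \<longlonglongrightarrow> 0"
  proof (rule tendstoI)
    fix r :: real assume "0 < r"
    have "eventually (\<lambda>n. f n \<le> 2 * (c + c * r / 2) * log q (real n) / real n) sequentially"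
      using c \<open>0 < r\<close> by (intro ev) simp
    then show "eventually (\<lambda>n. dist (\<epsilon> n) 0 < r) sequentially"
      using eventually_gt_at_top[of 1]
    proof eventually_elim
      case (elim n)
      then have pos: "0 < log q (real n)" "0 < real n" using q by auto
      have "f n * real n \<le> 2 * (c + c * r / 2) * log q (real n)"
        using elim pos by (simp add: field_simps)
      also have "\<dots> = (1 + r / 2) * (2 * c * log q (real n))" by (simp add: algebra_simps)
      finally have "f n * real n / (2 * c * log q (real n)) \<le> 1 + r / 2"
        using pos c by (simp add: pos_divide_le_eq)
      then show ?case using \<open>0 < r\<close> by (simp add: \<epsilon>_def)
    qed
  qed
  fix n :: nat assume "1 \<le> n"
  show "f n \<le> 2 * (1 + \<epsilon> n) * c * log q (real n) / real n"
  proof (cases "n = 1")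
    case True
    then show ?thesis using one by simp
  next
    case False
    then have pos: "0 < log q (real n)" "0 < real n" using \<open>1 \<le> n\<close> q by auto
    have "f n * real n / (2 * c * log q (real n)) \<le> 1 + \<epsilon> n" by (simp add: \<epsilon>_def)
    then have "f n * real n \<le> (1 + \<epsilon> n) * (2 * c * log q (real n))"
      using pos c by (simp add: pos_divide_le_eq)
    then show ?thesis using pos by (simp add: field_simps)
  qed
qed

theorem mainTheorem1:
  fixes P :: "(int \<Rightarrow> 'a::finite) measure" and \<beta> :: real and H1 :: real
  defines "q \<equiv> real CARD('a)"
  assumes beta_pos: "\<beta> > 0"
    and se: "stationary_ergodic P"
    and H1_lim: "(\<lambda>t. renyi_entropy q 1 (blocks (2*t+1)) (block_prob P t) / real (2*t+1))
                   \<longlonglongrightarrow> H1"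
    and Hminf_finite: "convergent (\<lambda>t. renyi_entropy_minf q (blocks (2*t+1)) (block_prob P t)
                          / real (2*t+1))"
    and mixing: "summable (mixing_coeff P)"
    and R_lt1: "(SUP s \<in> {1::nat..}. measure P {x \<in> space P. x 1 = x (1 + int s)}) < 1"
  shows "\<exists>\<epsilon> :: nat \<Rightarrow> real. \<epsilon> \<longlonglongrightarrow> 0 \<and>
           (\<forall>n \<ge> 1. opt_error P n (read_len q \<beta> n)
              \<le> 2 * (1 + \<epsilon> n) * (if H1 = 0 then \<beta> else min \<beta> (1 / H1))
                  * log q (real n) / real n)"
proof -
  interpret mixing_process P
    using se mixing R_lt1
    by (auto simp: mixing_process_def mixing_process_axioms_def stationary_process_def
        stationary_process_axioms_def stationary_ergodic_def)
  have "CARD('a) \<noteq> 1"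
  proof
    assume "CARD('a) = 1"
    then obtain a :: 'a where a: "UNIV = {a}" by (auto simp: card_1_singleton_iff)
    then have "u = v" for u v :: 'a by (metis UNIV_I singletonD)
    then have "{x. x 1 = x (1 + int 1)} = space P" by auto
    then show False using prob_agree_le[of 1 1] agreement_less_1 prob_space by simp
  qed
  then have "1 < CARD('a)"
    using zero_less_card_finite[where 'a = 'a] by linarith
  then have q: "1 < q" by (simp add: q_def)
  have block_prob: "block_prob P t w = word_prob w" if "w \<in> blocks (2 * t + 1)" for t w
  \<comment> \<open>The base \<open>q\<close> would be 1 in this case, where logarithms
    degenerate.\<close>
  proof -
    \<comment> \<open>The entropy rate uses windows centred at 0; stationarity moves their start
      from \<open>- t\<close> to 0.\<close>
    have "{x \<in> space P. \<forall>k<2 * t + 1. x (int k - int t) = w ! k} = {x. read (2 * t + 1) x (- int t) = w}"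
      using that by (auto simp: list_eq_iff_nth_eq blocks_def)
    then show ?thesis using prob_read_eq[OF that] by (simp add: block_prob_def)
  qed
  have "renyi_entropy q 1 (blocks (2 * t + 1)) (block_prob P t) = block_entropy q (2 * t + 1)" for t
  proof -
    have "(\<Sum>w\<in>{w \<in> blocks (2 * t + 1). block_prob P t w > 0}. block_prob P t w * log q (block_prob P t w))
        = (\<Sum>w\<in>blocks (2 * t + 1). word_prob w * log q (word_prob w))"
      by (rule sum.mono_neutral_cong_left) (auto simp: block_prob less_le)
    then show ?thesis by (simp add: renyi_entropy_def block_entropy_def)
  qed
  with H1_lim have lim: "(\<lambda>t. block_entropy q (2 * t + 1) / real (2 * t + 1)) \<longlonglongrightarrow> H1"
    by simp
  have H1: "0 \<le> H1"
    by (rule LIMSEQ_le_const[OF lim]) (use block_entropy_nonneg[OF q] in auto)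
  have one: "opt_error P 1 (read_len q \<beta> 1) \<le> 0"
    using opt_error_length_0 by (simp add: read_len_def)
  let ?c = "if H1 = 0 then \<beta> else min \<beta> (1 / H1)"
  show ?thesis
  proof (rule asymptotic_bound_imp_sequence[where f = "\<lambda>n. opt_error P n (read_len q \<beta> n)", OF q _ one])
    show "0 < ?c" using beta_pos H1 by auto
    fix \<eta> :: real assume "0 < \<eta>"
    show "eventually (\<lambda>n. opt_error P n (read_len q \<beta> n) \<le> 2 * (?c + \<eta>) * log q (real n) / real n) sequentially"
    \<comment> \<open>If the minimum is \<open>\<beta>\<close>, including the convention for
      \<open>H1 = 0\<close>, the constant detector attains the bound; otherwise the matching
      detector does.\<close>
    proof (cases "H1 = 0 \<or> \<beta> \<le> 1 / H1")
      case True
      then have "?c = \<beta>" by auto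
      then show ?thesis using opt_error_trivial_asymp[OF q beta_pos \<open>0 < \<eta>\<close>] by simp
    next
      case False
      then have "?c = 1 / H1" "0 < H1" using H1 by auto
      then show ?thesis using opt_error_entropy_asymp[OF q beta_pos \<open>0 < \<eta>\<close> _ lim] by simp
    qed
  qed
qed

end
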